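(* There exists a numerical constant $C>0$ such that the following holds. Fix $M\ge3$, $n\ge1$, $D\in[M]$, $B\ge1$, $q\in(0,1)$, $R>0$ and $\delta\in(0,1/2)$. Let $\mu_1,\dots,\mu_M\in\mathbb{R}^n$ be deterministic with $\max_j\|\mu_j\|^2\le B^2$, and let $Y=\mu+\xi$ with $\mu\in\mathbb{R}^n$, $\xi\sim\mathcal{N}(0,\sigma^2I_n)$. Then, for $\lambda=20\sigma^2$, the $Q$-aggregate estimator $\hat\mu^Q$ (defined in the context, with $\nu=1/2$) satisfies, with probability at least $1-\delta$, the following oracle inequalities simultaneously: for every $$\Theta\in\{\mathsf{B}_0(1)\cap\mathsf{B}_1(1),\ \mathsf{B}_1(1),\ \mathbb{R}^M,\ \mathsf{B}_0(D),\ \mathsf{B}_0(D)\cap\mathsf{B}_1(1),\ \mathsf{B}_q(R),\ \mathsf{B}_0(D)\cap\mathsf{B}_q(R)\},$$ $$\|\hat\mu^Q-\mu\|^2\le\min_{\theta\in\Theta}\|\mu_\theta-\mu\|^2+C\,\Delta_{n,M}(\Theta),$$ where, with $\vee=\max$ and $\wedge=\min$, - $\Delta_{n,M}(\mathsf{B}_0(1)\cap\mathsf{B}_1(1))=\sigma^2\log(\frac M\delta)$; - $\Delta_{n,M}(\mathsf{B}_1(1))=\Big[\sigma B\sqrt{\overline{\log}(\frac{\sigma M}{\delta B})}\vee\sigma^2\overline{\log}(\frac M\delta)\Big]\wedge\sigma^2M\log(\frac1\delta)$; - $\Delta_{n,M}(\mathbb{R}^M)=\sigma^2M\log(\frac1\delta)$;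 - $\Delta_{n,M}(\mathsf{B}_0(D))=\sigma^2D\log(\frac{M}{\delta D})$; - $\Delta_{n,M}(\mathsf{B}_0(D)\cap\mathsf{B}_1(1))=\Big[\sigma B\sqrt{\overline{\log}(\frac{\sigma M}{\delta B})}\vee\sigma^2\overline{\log}(\frac M\delta)\Big]\wedge\sigma^2D\log(\frac{M}{\delta D})$; - $\Delta_{n,M}(\mathsf{B}_q(R))=\Big[\sigma^{2-q}R^qB^q\big[\overline{\log}\big(\frac M\delta(\frac{\sigma}{BR})^q\big)\big]^{1-\frac q2}\vee\sigma^2\overline{\log}(\frac M\delta)\Big]\wedge\sigma^2M\log(\frac1\delta)$; - $\Delta_{n,M}(\mathsf{B}_0(D)\cap\mathsf{B}_q(R))=\Big[\sigma^{2-q}R^qB^q\big[\overline{\log}\big(\frac M\delta(\frac{\sigma}{BR})^q\big)\big]^{1-\frac q2}\vee\sigma^2\overline{\log}(\frac M\delta)\Big]\wedge\sigma^2D\log(\frac{M}{\delta D})$.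
   Context: $[M]=\{1,\dots,M\}$; $\|\cdot\|$ is the Euclidean norm; $\mu$ is deterministic and unknown, $\sigma>0$ known; $\overline{\log}(x)=\max(\log x,1)$. For $\theta\in\mathbb{R}^M$, $\mu_\theta=\sum_{j=1}^M\theta_j\mu_j$, $|\theta|_0$ is the number of nonzero coefficients of $\theta$ (with the convention $|0|_0=1$), $|\theta|_q=(\sum_j|\theta_j|^q)^{1/q}$ for $q\in(0,1]$, and $\mathsf{B}_q(R)=\{\theta\in\mathbb{R}^M:|\theta|_q\le R\}$ for $q\in[0,1]$. Definition of $\hat\mu^Q$ (sparsity pattern aggregation with the vectors $\mu_1,\dots,\mu_M$ as design vectors): for $J\subset[M]$ let $A_J$ be the orthogonal projection of $\mathbb{R}^n$ onto the span of $\{\mu_j\}_{j\in J}$ ($A_\emptyset=0$), $\hat\mu_J=A_JY$, $C_J=4\sigma^2\,\mathrm{Tr}(A_J)$, and let $\pi$ be the probability distribution on subsets of $[M]$ with $\pi_J\propto e^{-|J|}/\binom{M}{|J|}$. For a probability vector $w=(w_J)_{J\subset[M]}$ let $\mathcal{K}(w,\pi)=\sum_Jw_J\log(w_J/\pi_J)$ (with $0\log0=0$) and $$Q(w)=\nu\sum_Jw_J\|Y-\hat\mu_J\|^2+(1-\nu)\Big\|Y-\sum_Jw_J\hat\mu_J\Big\|^2+\sum_Jw_JC_J+\lambda\mathcal{K}(w,\pi).$$ Then $\hat\mu^Q=\sum_J\hat w_J\hat\mu_J$, where $\hat w$ minimizes $Q$ over all probability vectors, with $\nu=1/2$. *)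

theory Defs
  imports "HOL-Probability.Probability"
begin

(* The constant of the theorem must not depend on the dimensions, so these cannot be types.
   A vector of length k is a function on {1..k} that is undefined elsewhere; this makes
   rvec n exactly the space of the product measure gaussian n sigma. *)
definition rvec :: "nat \<Rightarrow> (nat \<Rightarrow> real) set" where
  "rvec k = {1..k} \<rightarrow>\<^sub>E UNIV"

abbreviation enorm :: "nat \<Rightarrow> (nat \<Rightarrow> real) \<Rightarrow> real" where
  "enorm n v \<equiv> L2_set v {1..n}"

definition vadd :: "nat \<Rightarrow> (nat \<Rightarrow> real) \<Rightarrow> (nat \<Rightarrow> real) \<Rightarrow> (nat \<Rightarrow> real)" where
  "vadd n u v = (\<lambda>i\<in>{1..n}. u i + v i)"

definition vdiff :: "nat \<Rightarrow> (nat \<Rightarrow> real) \<Rightarrow> (nat \<Rightarrow> real) \<Rightarrow> (nat \<Rightarrow> real)" where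
  "vdiff n u v = (\<lambda>i\<in>{1..n}. u i - v i)"

definition vinner :: "nat \<Rightarrow> (nat \<Rightarrow> real) \<Rightarrow> (nat \<Rightarrow> real) \<Rightarrow> real" where
  "vinner n u v = (\<Sum>i\<in>{1..n}. u i * v i)"

definition unit_vec :: "nat \<Rightarrow> nat \<Rightarrow> (nat \<Rightarrow> real)" where
  "unit_vec n k = (\<lambda>i\<in>{1..n}. if i = k then 1 else 0)"

definition lin_comb :: "nat \<Rightarrow> 'i set \<Rightarrow> ('i \<Rightarrow> real) \<Rightarrow> ('i \<Rightarrow> nat \<Rightarrow> real) \<Rightarrow> (nat \<Rightarrow> real)" where
  "lin_comb n I c v = (\<lambda>i\<in>{1..n}. \<Sum>j\<in>I. c j * v j i)"

definition gaussian :: "nat \<Rightarrow> real \<Rightarrow> (nat \<Rightarrow> real) measure" where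
  "gaussian n \<sigma> = PiM {1..n} (\<lambda>_. density lborel (\<lambda>x. ennreal (normal_density 0 \<sigma> x)))"

definition logbar :: "real \<Rightarrow> real" where
  "logbar x = max (ln x) 1"

(* For q = 0 the outer max implements the convention that the zero vector has size 1. *)
definition qnorm :: "nat \<Rightarrow> real \<Rightarrow> (nat \<Rightarrow> real) \<Rightarrow> real" where
  "qnorm M q \<theta> =
     (if q = 0 then real (max 1 (card {j \<in> {1..M}. \<theta> j \<noteq> 0}))
      else (\<Sum>j\<in>{1..M}. \<bar>\<theta> j\<bar> powr q) powr (1 / q))"

definition qball :: "nat \<Rightarrow> real \<Rightarrow> real \<Rightarrow> (nat \<Rightarrow> real) set" where
  "qball M q R = {\<theta> \<in> rvec M. qnorm M q \<theta> \<le> R}"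

definition fspan :: "nat \<Rightarrow> (nat \<Rightarrow> nat \<Rightarrow> real) \<Rightarrow> nat set \<Rightarrow> (nat \<Rightarrow> real) set" where
  "fspan n \<mu>s J = range (\<lambda>c. lin_comb n J c \<mu>s)"

definition proj :: "nat \<Rightarrow> (nat \<Rightarrow> nat \<Rightarrow> real) \<Rightarrow> nat set \<Rightarrow> (nat \<Rightarrow> real) \<Rightarrow> (nat \<Rightarrow> real)" where
  "proj n \<mu>s J y =
     (THE p. p \<in> fspan n \<mu>s J \<and> (\<forall>v\<in>fspan n \<mu>s J. vinner n (vdiff n y p) v = 0))"

definition trace_op :: "nat \<Rightarrow> ((nat \<Rightarrow> real) \<Rightarrow> (nat \<Rightarrow> real)) \<Rightarrow> real" where
  "trace_op n A = (\<Sum>i\<in>{1..n}. A (unit_vec n i) i)"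

definition prior_weight :: "nat \<Rightarrow> nat set \<Rightarrow> real" where
  "prior_weight M J = exp (- real (card J)) / real (M choose card J)"

definition prior :: "nat \<Rightarrow> nat set \<Rightarrow> real" where
  "prior M J = prior_weight M J / (\<Sum>J'\<in>Pow {1..M}. prior_weight M J')"

definition prob_vectors :: "nat \<Rightarrow> (nat set \<Rightarrow> real) set" where
  "prob_vectors M =
     {w \<in> Pow {1..M} \<rightarrow>\<^sub>E UNIV. (\<forall>J\<in>Pow {1..M}. 0 \<le> w J) \<and> (\<Sum>J\<in>Pow {1..M}. w J) = 1}"

(* The factor w J makes the value of ln at 0 irrelevant, so 0 log 0 = 0 holds. *)
definition KL :: "nat \<Rightarrow> (nat set \<Rightarrow> real) \<Rightarrow> real" where
  "KL M w = (\<Sum>J\<in>Pow {1..M}. w J * ln (w J / prior M J))"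

definition aggregate ::
  "nat \<Rightarrow> nat \<Rightarrow> (nat \<Rightarrow> nat \<Rightarrow> real) \<Rightarrow> (nat \<Rightarrow> real) \<Rightarrow> (nat set \<Rightarrow> real) \<Rightarrow> (nat \<Rightarrow> real)" where
  "aggregate n M \<mu>s Y w = lin_comb n (Pow {1..M}) w (\<lambda>J. proj n \<mu>s J Y)"

definition Q_crit ::
  "nat \<Rightarrow> nat \<Rightarrow> real \<Rightarrow> real \<Rightarrow> real \<Rightarrow> (nat \<Rightarrow> nat \<Rightarrow> real) \<Rightarrow> (nat \<Rightarrow> real) \<Rightarrow> (nat set \<Rightarrow> real) \<Rightarrow> real"
where
  "Q_crit n M \<sigma> \<nu> \<kappa> \<mu>s Y w =
     \<nu> * (\<Sum>J\<in>Pow {1..M}. w J * (enorm n (vdiff n Y (proj n \<mu>s J Y)))\<^sup>2)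
     + (1 - \<nu>) * (enorm n (vdiff n Y (aggregate n M \<mu>s Y w)))\<^sup>2
     + (\<Sum>J\<in>Pow {1..M}. w J * (4 * \<sigma>\<^sup>2 * trace_op n (proj n \<mu>s J)))
     + \<kappa> * KL M w"

(* For kappa > 0 and nu in [0,1] the criterion is continuous and strictly convex on the
   compact simplex, so the choice made by arg_min_on is the unique minimizer. *)
definition Q_estimator ::
  "nat \<Rightarrow> nat \<Rightarrow> real \<Rightarrow> real \<Rightarrow> real \<Rightarrow> (nat \<Rightarrow> nat \<Rightarrow> real) \<Rightarrow> (nat \<Rightarrow> real) \<Rightarrow> (nat \<Rightarrow> real)" where
  "Q_estimator n M \<sigma> \<nu> \<kappa> \<mu>s Y =
     aggregate n M \<mu>s Y (arg_min_on (Q_crit n M \<sigma> \<nu> \<kappa> \<mu>s Y) (prob_vectors M))"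

definition oracle_ineq ::
  "nat \<Rightarrow> nat \<Rightarrow> (nat \<Rightarrow> nat \<Rightarrow> real) \<Rightarrow> (nat \<Rightarrow> real) \<Rightarrow> (nat \<Rightarrow> real) \<Rightarrow> (nat \<Rightarrow> real) set \<Rightarrow> real \<Rightarrow> bool"
where
  "oracle_ineq n M \<mu>s \<mu> est \<Theta> r \<longleftrightarrow>
     (enorm n (vdiff n est \<mu>))\<^sup>2
       \<le> (INF \<theta>\<in>\<Theta>. (enorm n (vdiff n (lin_comb n {1..M} \<theta> \<mu>s) \<mu>))\<^sup>2) + r"

definition l1_term :: "nat \<Rightarrow> real \<Rightarrow> real \<Rightarrow> real \<Rightarrow> real" where
  "l1_term M \<sigma> B \<delta> =
     max (\<sigma> * B * sqrt (logbar (\<sigma> * real M / (\<delta> * B)))) (\<sigma>\<^sup>2 * logbar (real M / \<delta>))"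

definition lq_term :: "nat \<Rightarrow> real \<Rightarrow> real \<Rightarrow> real \<Rightarrow> real \<Rightarrow> real \<Rightarrow> real" where
  "lq_term M \<sigma> B q R \<delta> =
     max (\<sigma> powr (2 - q) * R powr q * B powr q
            * (logbar (real M / \<delta> * (\<sigma> / (B * R)) powr q)) powr (1 - q / 2))
         (\<sigma>\<^sup>2 * logbar (real M / \<delta>))"

end

theory Submission
  imports Defs
begin

text \<open>The argument has a deterministic part, a probabilistic part and an approximation part.

Deterministic part.  Write f_K for the projection of Y on the span of the vectors indexed by K and
f_w for their average under a weight vector w.  The criterion is strongly convex as a function of
the aggregate, so its minimizer \<open>w\<close> beats every point mass at J by a margin of
\<open>1/2 * |f_w - f_J|^2\<close> (\<open>Q_crit_minimizer_strong\<close>).  The average of the losses in the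
criterion contributes half of the w-average of \<open>|f_K - f_w|^2\<close>, and both terms add up to
half of the w-average of \<open>|f_K - f_J|^2\<close>.
After substituting \<open>Y = \<mu> + \<xi>\<close>, the noise enters only through the w-average of
\<open>2 <\<xi>, f_K - f_J> - 1/2 |f_K - f_J|^2\<close>.  Since f_K - f_J lies in the span indexed by
\<open>K \<union> J\<close>, this is at most \<open>2 |A \<xi>|^2\<close> for the projection A on that span
(\<open>noise_absorption\<close>): the unknown mean disappears.  The entropy penalty then turns the
w-average into a log-partition function that no longer depends on w
(\<open>gibbs_variational\<close>, \<open>estimator_bound\<close>).

Probabilistic part.  Adding the variance \<open>|A_J \<xi>|^2\<close> of f_J to the noise term gives at most
\<open>3 |A \<xi>|^2\<close>, and the temperature is \<open>20 * \<sigma>^2\<close>.  If the span of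
\<open>K \<union> J\<close> has dimension m, then \<open>|A \<xi>|^2 / \<sigma>^2\<close> has a chi-square distribution
with m degrees of freedom, and its exponential moment of order 3/20 is at most \<open>exp (m / 5)\<close>
(\<open>gaussian_exp_projection_bound\<close>).  The penalty
\<open>4 * \<sigma>^2 * Tr A_K\<close> divided by \<open>20 * \<sigma>^2\<close> removes \<open>exp (dim K / 5)\<close>,
which leaves only \<open>exp (|J| / 5)\<close>.  Weighting by the prior in J as well and using Markov's
inequality once gives an event of probability \<open>1 - \<delta>\<close> that works for all J
simultaneously (\<open>noise_partition_event\<close>).  On it, for every J with d elements and every v in
the span indexed by J, the risk is at most \<open>|v - \<mu>|^2\<close> plus a multiple of
\<open>\<sigma>^2 * d * ln (M / (\<delta> * d))\<close> (\<open>sparse_oracle_inequality\<close>).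

Approximation part.  The classes without a norm constraint follow by taking d = D or d = M.  For an
\<open>\<ell>_q\<close> ball, the large coefficients are kept and the remaining part, whose
\<open>\<ell>_1\<close> norm is small, is replaced by a k-term combination with Maurey's sampling argument
(\<open>qball_sparse_approximation\<close>); choosing k so that approximation error and dimension term
balance gives the rate (\<open>qball_oracle_inequality\<close>).  The case q = 1, R = 1 is the
\<open>\<ell>_1\<close> ball.  For an intersection, each of the two bounds remains valid because the
infimum is over a smaller set.\<close>

(* Index sets are {1..n}; the simplifier should not turn them into {Suc 0..n}. *)
declare One_nat_def [simp del]

section \<open>Inner products and spans of coordinate vectors\<close>

lemma enorm_sq: "(enorm n v)\<^sup>2 = vinner n v v"
  by (simp add: L2_set_def vinner_def sum_nonneg power2_eq_square)

lemma vinner_commute: "vinner n u v = vinner n v u"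
  by (simp add: vinner_def mult.commute)

lemma vinner_nonneg: "0 \<le> vinner n v v"
  by (simp add: vinner_def sum_nonneg)

lemma vinner_self_eq_0: "vinner n v v = 0 \<longleftrightarrow> (\<forall>i\<in>{1..n}. v i = 0)"
  unfolding vinner_def by (subst sum_nonneg_eq_0_iff) auto

lemma vinner_cong:
  "(\<And>i. i \<in> {1..n} \<Longrightarrow> u i = u' i) \<Longrightarrow> (\<And>i. i \<in> {1..n} \<Longrightarrow> v i = v' i) \<Longrightarrow> vinner n u v = vinner n u' v'"
  by (simp add: vinner_def)

lemma vinner_vdiff:
  "vinner n (vdiff n u v) w = vinner n u w - vinner n v w"
  "vinner n w (vdiff n u v) = vinner n w u - vinner n w v"
  by (simp_all add: vinner_def vdiff_def algebra_simps sum_subtractf)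

lemma vinner_vadd:
  "vinner n (vadd n u v) w = vinner n u w + vinner n v w"
  "vinner n w (vadd n u v) = vinner n w u + vinner n w v"
  by (simp_all add: vinner_def vadd_def algebra_simps sum.distrib)

lemma vinner_lin_comb:
  "vinner n (lin_comb n I c v) w = (\<Sum>i\<in>I. c i * vinner n (v i) w)"
  "vinner n w (lin_comb n I c v) = (\<Sum>i\<in>I. c i * vinner n w (v i))"
proof -
  have "vinner n (lin_comb n I c v) w = (\<Sum>k\<in>{1..n}. \<Sum>i\<in>I. c i * (v i k * w k))"
    by (simp add: vinner_def lin_comb_def sum_distrib_right mult.assoc)
  also have "\<dots> = (\<Sum>i\<in>I. c i * vinner n (v i) w)"
    by (subst sum.swap) (simp add: vinner_def sum_distrib_left)
  finally show 1: "vinner n (lin_comb n I c v) w = (\<Sum>i\<in>I. c i * vinner n (v i) w)" .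
  show "vinner n w (lin_comb n I c v) = (\<Sum>i\<in>I. c i * vinner n w (v i))"
    unfolding vinner_commute[of n w] 1 ..
qed

lemmas vinner_simps = vinner_vdiff vinner_vadd vinner_lin_comb

lemma lin_comb_apply: "i \<in> {1..n} \<Longrightarrow> lin_comb n I c v i = (\<Sum>j\<in>I. c j * v j i)"
  by (simp add: lin_comb_def)

lemma lin_comb_in_fspan: "lin_comb n J c \<mu>s \<in> fspan n \<mu>s J"
  by (simp add: fspan_def)

lemma fspanE:
  assumes "p \<in> fspan n \<mu>s J"
  obtains c where "p = lin_comb n J c \<mu>s"
  using assms by (auto simp: fspan_def)

lemma fspan_eqI:
  assumes "p \<in> fspan n \<mu>s J" "p' \<in> fspan n \<mu>s J'" "\<And>i. i \<in> {1..n} \<Longrightarrow> p i = p' i"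
  shows "p = p'"
  using assms by (auto simp: fspan_def lin_comb_def fun_eq_iff restrict_def)

lemma lin_comb_mem_fspan:
  assumes "\<And>i. i \<in> I \<Longrightarrow> v i \<in> fspan n \<mu>s J"
  shows "lin_comb n I c v \<in> fspan n \<mu>s J"
proof -
  have "\<forall>i\<in>I. \<exists>d. v i = lin_comb n J d \<mu>s"
    using assms by (auto simp: fspan_def)
  then obtain d where d: "\<And>i. i \<in> I \<Longrightarrow> v i = lin_comb n J (d i) \<mu>s"
    by metis
  have "lin_comb n I c v = lin_comb n J (\<lambda>j. \<Sum>i\<in>I. c i * d i j) \<mu>s"
  proof (unfold lin_comb_def, rule restrict_ext)
    fix k assume k: "k \<in> {1..n}"
    have "(\<Sum>i\<in>I. c i * v i k) = (\<Sum>i\<in>I. \<Sum>j\<in>J. c i * d i j * \<mu>s j k)"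
      using d k by (simp add: lin_comb_def sum_distrib_left mult.assoc)
    also have "\<dots> = (\<Sum>j\<in>J. (\<Sum>i\<in>I. c i * d i j) * \<mu>s j k)"
      by (subst sum.swap) (simp add: sum_distrib_right)
    finally show "(\<Sum>i\<in>I. c i * v i k) = (\<Sum>j\<in>J. (\<Sum>i\<in>I. c i * d i j) * \<mu>s j k)" .
  qed
  then show ?thesis by (simp add: lin_comb_in_fspan)
qed

lemma vdiff_mem_fspan:
  assumes "u \<in> fspan n \<mu>s J" "v \<in> fspan n \<mu>s J"
  shows "vdiff n u v \<in> fspan n \<mu>s J"
proof -
  have "vdiff n u v = lin_comb n {True, False} (\<lambda>b. if b then 1 else -1) (\<lambda>b. if b then u else v)"
    by (auto simp: vdiff_def lin_comb_def)
  also have "\<dots> \<in> fspan n \<mu>s J"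
    using assms by (intro lin_comb_mem_fspan) auto
  finally show ?thesis .
qed

lemma fspan_mono:
  assumes "finite J'" "J \<subseteq> J'"
  shows "fspan n \<mu>s J \<subseteq> fspan n \<mu>s J'"
proof
  fix p assume "p \<in> fspan n \<mu>s J"
  then obtain c where p: "p = lin_comb n J c \<mu>s" by (rule fspanE)
  have "lin_comb n J c \<mu>s = lin_comb n J' (\<lambda>j. if j \<in> J then c j else 0) \<mu>s"
  proof (unfold lin_comb_def, rule restrict_ext)
    fix k
    show "(\<Sum>j\<in>J. c j * \<mu>s j k) = (\<Sum>j\<in>J'. (if j \<in> J then c j else 0) * \<mu>s j k)"
      using assms by (intro sum.mono_neutral_cong_left) auto
  qed
  then show "p \<in> fspan n \<mu>s J'" by (simp add: p lin_comb_in_fspan)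
qed

lemma generator_mem_fspan:
  assumes "finite J" "j \<in> J"
  shows "(\<lambda>i\<in>{1..n}. \<mu>s j i) \<in> fspan n \<mu>s J"
proof -
  have "(\<lambda>i\<in>{1..n}. \<mu>s j i) = lin_comb n {j} (\<lambda>_. 1) \<mu>s"
    by (auto simp: lin_comb_def)
  then show ?thesis
    using fspan_mono[of J "{j}"] assms lin_comb_in_fspan by (metis empty_subsetI insert_subset subsetD)
qed

section \<open>Orthonormal bases and projections\<close>

definition orthonormal :: "nat \<Rightarrow> (nat \<Rightarrow> real) set \<Rightarrow> bool" where
  "orthonormal n U \<longleftrightarrow> finite U \<and> (\<forall>u\<in>U. \<forall>v\<in>U. vinner n u v = (if u = v then 1 else 0))"

text \<open>The expansion is required for the generators only; it extends to the whole span by linearity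
(\<open>span_basis_expand\<close>), and in this form it is easy to preserve when a generator is added.\<close>

definition span_basis :: "nat \<Rightarrow> (nat \<Rightarrow> nat \<Rightarrow> real) \<Rightarrow> nat set \<Rightarrow> (nat \<Rightarrow> real) set \<Rightarrow> bool" where
  "span_basis n \<mu>s J U \<longleftrightarrow> orthonormal n U \<and> U \<subseteq> fspan n \<mu>s J \<and>
     (\<forall>j\<in>J. \<forall>i\<in>{1..n}. \<mu>s j i = (\<Sum>u\<in>U. vinner n u (\<mu>s j) * u i))"

lemma span_basisD:
  assumes "span_basis n \<mu>s J U"
  shows "finite U" "\<And>u v. u \<in> U \<Longrightarrow> v \<in> U \<Longrightarrow> vinner n u v = (if u = v then 1 else 0)"
    "\<And>u. u \<in> U \<Longrightarrow> u \<in> fspan n \<mu>s J"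
    "\<And>j i. j \<in> J \<Longrightarrow> i \<in> {1..n} \<Longrightarrow> \<mu>s j i = (\<Sum>u\<in>U. vinner n u (\<mu>s j) * u i)"
  using assms by (auto simp: span_basis_def orthonormal_def)

lemma orthonormal_coeff:
  assumes "orthonormal n U" "u \<in> U"
  shows "vinner n u (lin_comb n U c (\<lambda>u. u)) = c u"
proof -
  have "vinner n u (lin_comb n U c (\<lambda>u. u)) = (\<Sum>v\<in>U. c v * (if u = v then 1 else 0))"
    using assms by (auto simp: vinner_simps orthonormal_def intro!: sum.cong)
  also have "\<dots> = (\<Sum>v\<in>U. if u = v then c v else 0)"
    by (intro sum.cong) auto
  also have "\<dots> = c u"
    using assms by (simp add: orthonormal_def)
  finally show ?thesis .
qed

lemma orthonormal_norm:
  assumes "orthonormal n U"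
  shows "vinner n (lin_comb n U c (\<lambda>u. u)) (lin_comb n U c (\<lambda>u. u)) = (\<Sum>u\<in>U. (c u)\<^sup>2)"
  unfolding vinner_lin_comb(1)
  by (intro sum.cong) (simp_all add: orthonormal_coeff[OF assms] power2_eq_square)

lemma span_basis_expand:
  assumes "span_basis n \<mu>s J U" "v \<in> fspan n \<mu>s J"
  shows "v = lin_comb n U (\<lambda>u. vinner n u v) (\<lambda>u. u)"
proof (rule fspan_eqI[OF assms(2)])
  show "lin_comb n U (\<lambda>u. vinner n u v) (\<lambda>u. u) \<in> fspan n \<mu>s J"
    using span_basisD(3)[OF assms(1)] by (rule lin_comb_mem_fspan)
  obtain c where v: "v = lin_comb n J c \<mu>s" using assms(2) by (rule fspanE)
  fix i assume i: "i \<in> {1..n}"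
  have "v i = (\<Sum>j\<in>J. \<Sum>u\<in>U. c j * vinner n u (\<mu>s j) * u i)"
    using i span_basisD(4)[OF assms(1)]
    by (simp add: v lin_comb_apply flip: mult.assoc sum_distrib_left)
       (simp add: sum_distrib_left mult.assoc)
  also have "\<dots> = lin_comb n U (\<lambda>u. vinner n u v) (\<lambda>u. u) i"
    using i by (subst sum.swap) (simp add: lin_comb_apply v vinner_simps sum_distrib_right)
  finally show "v i = lin_comb n U (\<lambda>u. vinner n u v) (\<lambda>u. u) i" .
qed

text \<open>One Gram-Schmidt step: subtract from the new generator its projection on the old span, and
normalize the remainder unless it vanishes.\<close>

lemma span_basis_insert:
  assumes "span_basis n \<mu>s K U" "finite K"
  shows "\<exists>U'. span_basis n \<mu>s (insert j K) U' \<and> card U' \<le> card U + 1"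
proof -
  note U = span_basisD[OF assms(1)]
  have on: "orthonormal n U" using assms(1) by (simp add: span_basis_def)
  define x where "x = (\<lambda>i\<in>{1..n}. \<mu>s j i)"
  define p where "p = lin_comb n U (\<lambda>u. vinner n u x) (\<lambda>u. u)"
  define r where "r = vdiff n x p"
  have KsubJ: "fspan n \<mu>s K \<subseteq> fspan n \<mu>s (insert j K)"
    using assms(2) by (intro fspan_mono) auto
  have x_in: "x \<in> fspan n \<mu>s (insert j K)"
    unfolding x_def using assms(2) by (intro generator_mem_fspan) auto
  have p_in: "p \<in> fspan n \<mu>s K"
    unfolding p_def using U(3) by (rule lin_comb_mem_fspan)
  have r_in: "r \<in> fspan n \<mu>s (insert j K)"
    unfolding r_def using x_in p_in KsubJ by (intro vdiff_mem_fspan) auto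
  have ur: "vinner n u r = 0" if "u \<in> U" for u
    using orthonormal_coeff[OF on that] by (simp add: r_def vinner_simps(2) p_def)
  have vr: "vinner n v r = 0" if "v \<in> fspan n \<mu>s K" for v
    by (subst span_basis_expand[OF assms(1) that]) (simp add: vinner_lin_comb ur)
  have "vinner n r r = vinner n x r - vinner n p r"
    by (subst (1) r_def) (simp add: vinner_vdiff(1))
  then have xr: "vinner n x r = vinner n r r"
    using vr[OF p_in] by simp
  have xs: "vinner n u (\<mu>s j) = vinner n u x" for u
    by (rule vinner_cong) (auto simp: x_def)
  show ?thesis
  proof (cases "vinner n r r = 0")
    case True
    then have "\<mu>s j i = (\<Sum>u\<in>U. vinner n u (\<mu>s j) * u i)" if "i \<in> {1..n}" for i
      using that unfolding vinner_self_eq_0 xs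
      by (auto simp: r_def vdiff_def p_def lin_comb_apply x_def)
    then have "span_basis n \<mu>s (insert j K) U"
      using assms(1) KsubJ by (auto simp: span_basis_def)
    then show ?thesis by auto
  next
    case False
    define s where "s = sqrt (vinner n r r)"
    have s: "s > 0" "s * s = vinner n r r"
      using False vinner_nonneg[of n r] by (auto simp: s_def)
    define e where "e = lin_comb n {r} (\<lambda>_. 1 / s) (\<lambda>r. r)"
    have e_in: "e \<in> fspan n \<mu>s (insert j K)"
      unfolding e_def using r_in by (intro lin_comb_mem_fspan) auto
    have ue: "vinner n u e = 0" if "u \<in> U" for u
      by (simp add: e_def vinner_simps ur[OF that])
    have ee: "vinner n e e = 1"
      using s False by (simp add: e_def vinner_simps)
    have eU: "e \<notin> U" using ue[of e] ee by auto
    have on': "orthonormal n (insert e U)"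
    proof -
      have "vinner n u v = (if u = v then 1 else 0)" if "u \<in> insert e U" "v \<in> insert e U" for u v
        using that U(2)[of u v] ue[of u] ue[of v] ee eU vinner_commute[of n e v] by (cases "u = e"; cases "v = e") auto
      then show ?thesis using U(1) by (simp add: orthonormal_def)
    qed
    have old: "\<mu>s k i = (\<Sum>u\<in>insert e U. vinner n u (\<mu>s k) * u i)"
      if "k \<in> K" "i \<in> {1..n}" for k i
    proof -
      have "vinner n e (\<mu>s k) = vinner n e (\<lambda>i\<in>{1..n}. \<mu>s k i)"
        by (rule vinner_cong) auto
      also have "\<dots> = 0"
        using vr[OF generator_mem_fspan[OF assms(2) that(1)]]
        by (simp add: e_def vinner_simps vinner_commute[of n r])
      finally show ?thesis using U(1) eU U(4)[OF that] by simp
    qed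
    have new: "\<mu>s j i = (\<Sum>u\<in>insert e U. vinner n u (\<mu>s j) * u i)" if i: "i \<in> {1..n}" for i
    proof -
      have "vinner n e (\<mu>s j) * e i = (vinner n r r / s / s) * r i"
        using i by (simp add: xs e_def vinner_simps vinner_commute[of n r x] xr lin_comb_apply)
      also have "\<dots> = r i" using s False by (simp add: field_simps)
      finally have "(\<Sum>u\<in>insert e U. vinner n u (\<mu>s j) * u i) = r i + p i"
        using i U(1) eU by (simp add: xs p_def lin_comb_apply)
      then show ?thesis using i by (simp add: r_def vdiff_def x_def)
    qed
    have "span_basis n \<mu>s (insert j K) (insert e U)"
      using on' e_in U(3) KsubJ old new by (auto simp: span_basis_def simp del: sum.insert)
    moreover have "card (insert e U) \<le> card U + 1"
      using U(1) eU by simp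
    ultimately show ?thesis by blast
  qed
qed

text \<open>The dimension of the span indexed by \<open>K \<union> J\<close> exceeds the dimension for K, and not
only the cardinality of K, by at most \<open>card J\<close>.  The penalty on K is its trace, that is,
this dimension, so the exact comparison matters for \<open>projection_moment\<close>.\<close>

lemma span_basis_Un:
  assumes "span_basis n \<mu>s K U" "finite K" "finite J"
  shows "\<exists>U'. span_basis n \<mu>s (K \<union> J) U' \<and> card U' \<le> card U + card J"
  using assms(3)
proof (induction J rule: finite_induct)
  case empty
  then show ?case using assms(1) by auto
next
  case (insert j J)
  then obtain U' where U': "span_basis n \<mu>s (K \<union> J) U'" "card U' \<le> card U + card J"
    by auto
  then obtain U'' where "span_basis n \<mu>s (insert j (K \<union> J)) U''" "card U'' \<le> card U' + 1"
    using span_basis_insert[of n \<mu>s "K \<union> J" U'] assms(2) insert.hyps by auto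
  then show ?case using U'(2) insert.hyps by (intro exI[of _ U'']) auto
qed

lemma span_basis_exists:
  assumes "finite J"
  shows "\<exists>U. span_basis n \<mu>s J U \<and> card U \<le> card J"
proof -
  have "span_basis n \<mu>s {} {}" by (simp add: span_basis_def orthonormal_def)
  from span_basis_Un[OF this _ assms] show ?thesis by simp
qed

text \<open>The explicit formula shows in particular that the defining description of the projection has
exactly one solution; all later facts about projections are read off from it.\<close>

lemma proj_eq:
  assumes "span_basis n \<mu>s J U"
  shows "proj n \<mu>s J y = lin_comb n U (\<lambda>u. vinner n u y) (\<lambda>u. u)" (is "_ = ?p")
proof -
  note U = span_basisD[OF assms]
  have on: "orthonormal n U" using assms by (simp add: span_basis_def)
  have p_in: "?p \<in> fspan n \<mu>s J" using U(3) by (rule lin_comb_mem_fspan)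
  have p_orth: "vinner n (vdiff n y ?p) v = 0" if v: "v \<in> fspan n \<mu>s J" for v
    using orthonormal_coeff[OF on]
    by (subst span_basis_expand[OF assms v])
       (simp add: vinner_lin_comb(2) vinner_vdiff vinner_commute[of n "lin_comb n U _ _"]
          vinner_commute[of n y])
  show ?thesis unfolding proj_def
  proof (rule the_equality)
    show "?p \<in> fspan n \<mu>s J \<and> (\<forall>v\<in>fspan n \<mu>s J. vinner n (vdiff n y ?p) v = 0)"
      using p_in p_orth by blast
    fix p assume p: "p \<in> fspan n \<mu>s J \<and> (\<forall>v\<in>fspan n \<mu>s J. vinner n (vdiff n y p) v = 0)"
    have d: "vdiff n p ?p \<in> fspan n \<mu>s J" using p p_in by (intro vdiff_mem_fspan) auto
    have "vinner n (vdiff n p ?p) (vdiff n p ?p)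
        = vinner n (vdiff n y ?p) (vdiff n p ?p) - vinner n (vdiff n y p) (vdiff n p ?p)"
      by (simp add: vinner_vdiff)
    also have "\<dots> = 0" using d p p_orth by simp
    finally show "p = ?p" using p p_in unfolding vinner_self_eq_0
      by (intro fspan_eqI[of p n \<mu>s J ?p J]) (auto simp: vdiff_def)
  qed
qed

lemma proj_in_fspan: "finite J \<Longrightarrow> proj n \<mu>s J y \<in> fspan n \<mu>s J"
  using span_basis_exists[of J n \<mu>s] by (auto simp: proj_eq span_basisD(3) intro!: lin_comb_mem_fspan)

lemma proj_inner:
  assumes "finite J" "v \<in> fspan n \<mu>s J"
  shows "vinner n (proj n \<mu>s J y) v = vinner n y v"
proof -
  obtain U where U: "span_basis n \<mu>s J U" using span_basis_exists[OF assms(1)] by blast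
  then have on: "orthonormal n U" by (simp add: span_basis_def)
  show ?thesis
    using orthonormal_coeff[OF on]
    by (subst (1 2) span_basis_expand[OF U assms(2)])
       (simp add: vinner_lin_comb(2) proj_eq[OF U] vinner_commute[of n "lin_comb n U _ _"]
          vinner_commute[of n y])
qed

lemma proj_sq:
  assumes "span_basis n \<mu>s J U"
  shows "vinner n (proj n \<mu>s J y) (proj n \<mu>s J y) = (\<Sum>u\<in>U. (vinner n u y)\<^sup>2)"
  unfolding proj_eq[OF assms] by (rule orthonormal_norm) (use assms in \<open>simp add: span_basis_def\<close>)

lemma proj_vadd:
  assumes "finite J" "i \<in> {1..n}"
  shows "proj n \<mu>s J (vadd n y z) i = proj n \<mu>s J y i + proj n \<mu>s J z i"
proof -
  obtain U where U: "span_basis n \<mu>s J U" using span_basis_exists[OF assms(1)] by blast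
  show ?thesis
    using assms(2) by (simp add: proj_eq[OF U] lin_comb_apply vinner_simps distrib_right sum.distrib)
qed

lemma trace_proj:
  assumes "span_basis n \<mu>s J U"
  shows "trace_op n (proj n \<mu>s J) = real (card U)"
proof -
  have e: "vinner n u (unit_vec n i) = u i" if "i \<in> {1..n}" for u i
  proof -
    have "vinner n u (unit_vec n i) = (\<Sum>k\<in>{1..n}. if i = k then u k else 0)"
      unfolding vinner_def by (intro sum.cong) (auto simp: unit_vec_def)
    then show ?thesis using that by simp
  qed
  have "trace_op n (proj n \<mu>s J) = (\<Sum>i\<in>{1..n}. \<Sum>u\<in>U. u i * u i)"
    unfolding trace_op_def by (intro sum.cong) (simp_all add: proj_eq[OF assms] lin_comb_apply e)
  also have "\<dots> = (\<Sum>u\<in>U. vinner n u u)"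
    by (subst sum.swap) (simp add: vinner_def)
  also have "\<dots> = real (card U)"
    using span_basisD(2)[OF assms] by simp
  finally show ?thesis .
qed

text \<open>Pythagoras: \<open>v - y\<close> is the orthogonal sum of \<open>v - A y\<close> and \<open>A y - y\<close>.\<close>

lemma proj_best:
  assumes "finite J" "v \<in> fspan n \<mu>s J"
  shows "(enorm n (vdiff n (proj n \<mu>s J y) y))\<^sup>2 \<le> (enorm n (vdiff n v y))\<^sup>2"
proof -
  let ?p = "proj n \<mu>s J y"
  have "vinner n (vdiff n v y) (vdiff n v y) =
      vinner n (vdiff n ?p y) (vdiff n ?p y) + vinner n (vdiff n v ?p) (vdiff n v ?p)"
    using proj_inner[OF assms, where y = y]
      proj_inner[OF assms(1) proj_in_fspan[OF assms(1)], where n = n and y = y and \<mu>s = \<mu>s and y1 = y]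
    by (simp add: vinner_vdiff vinner_commute)
  then show ?thesis using vinner_nonneg[of n "vdiff n v ?p"] unfolding enorm_sq by linarith
qed

section \<open>Exponential moments of Gaussian projections\<close>

abbreviation normal_law :: "real \<Rightarrow> real measure" where
  "normal_law \<sigma> \<equiv> density lborel (\<lambda>x. ennreal (normal_density 0 \<sigma> x))"

lemma nn_integral_normal_density:
  "0 < \<sigma> \<Longrightarrow> (\<integral>\<^sup>+x. ennreal (normal_density m \<sigma> x) \<partial>lborel) = 1"
  using prob_space.emeasure_space_1[OF prob_space_normal_density[of \<sigma> m]]
  by (simp add: emeasure_density)

text \<open>Completing the square turns the integrand into a multiple of a shifted normal density.\<close>

lemma normal_exp_linear:
  assumes "0 < \<sigma>"
  shows "(\<integral>\<^sup>+x. ennreal (exp (a * x)) \<partial>normal_law \<sigma>) = ennreal (exp (\<sigma>\<^sup>2 / 2 * a\<^sup>2))"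
proof -
  have "normal_density 0 \<sigma> x * exp (a * x) = exp (\<sigma>\<^sup>2 / 2 * a\<^sup>2) * normal_density (a * \<sigma>\<^sup>2) \<sigma> x" for x
  proof -
    have "- x\<^sup>2 / (2 * \<sigma>\<^sup>2) + a * x = \<sigma>\<^sup>2 / 2 * a\<^sup>2 + - (x - a * \<sigma>\<^sup>2)\<^sup>2 / (2 * \<sigma>\<^sup>2)"
      using assms by (simp add: field_simps power2_eq_square)
    then show ?thesis
      by (simp add: normal_density_def flip: exp_add)
  qed
  then have "(\<integral>\<^sup>+x. ennreal (exp (a * x)) \<partial>normal_law \<sigma>) =
     (\<integral>\<^sup>+x. ennreal (exp (\<sigma>\<^sup>2 / 2 * a\<^sup>2)) * ennreal (normal_density (a * \<sigma>\<^sup>2) \<sigma> x) \<partial>lborel)"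
    by (simp add: nn_integral_density flip: ennreal_mult)
  also have "\<dots> = ennreal (exp (\<sigma>\<^sup>2 / 2 * a\<^sup>2))"
    using assms by (simp add: nn_integral_cmult nn_integral_normal_density)
  finally show ?thesis .
qed

text \<open>The integrand is a multiple of a centred normal density with larger variance.\<close>

lemma normal_exp_square:
  assumes "0 \<le> c" "2 * c < 1"
  shows "(\<integral>\<^sup>+x. ennreal (exp (c * x\<^sup>2)) \<partial>normal_law 1) = ennreal (1 / sqrt (1 - 2 * c))"
proof -
  define s where "s = 1 / sqrt (1 - 2 * c)"
  have s: "s > 0" "s\<^sup>2 = 1 / (1 - 2 * c)"
    using assms by (auto simp: s_def power_divide)
  have "normal_density 0 1 x * exp (c * x\<^sup>2) = s * normal_density 0 s x" for x
  proof -
    have "- x\<^sup>2 / 2 + c * x\<^sup>2 = - x\<^sup>2 / (2 * s\<^sup>2)"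
      using assms by (simp add: s(2) field_simps)
    moreover have "s / sqrt (2 * pi * s\<^sup>2) = 1 / sqrt (2 * pi)"
      using s(1) by (simp add: real_sqrt_mult)
    ultimately show ?thesis
      by (simp add: normal_density_def field_simps flip: exp_add)
  qed
  then have "(\<integral>\<^sup>+x. ennreal (exp (c * x\<^sup>2)) \<partial>normal_law 1) =
     (\<integral>\<^sup>+x. ennreal s * ennreal (normal_density 0 s x) \<partial>lborel)"
    using s(1) by (simp add: nn_integral_density flip: ennreal_mult)
  also have "\<dots> = ennreal s"
    using s(1) by (simp add: nn_integral_cmult nn_integral_normal_density)
  finally show ?thesis by (simp add: s_def)
qed

lemma product_sigma_finite_normal:
  "0 < \<sigma> \<Longrightarrow> product_sigma_finite (\<lambda>_. normal_law \<sigma>)"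
  by (simp add: product_sigma_finite_def prob_space_imp_sigma_finite prob_space_normal_density)

lemma prob_space_gaussian: "0 < \<sigma> \<Longrightarrow> prob_space (gaussian n \<sigma>)"
  unfolding gaussian_def by (intro prob_space_PiM prob_space_normal_density)

lemma product_normal_exp_linear:
  assumes "finite I" "0 < \<sigma>"
  shows "(\<integral>\<^sup>+x. ennreal (exp (\<Sum>i\<in>I. a i * x i)) \<partial>PiM I (\<lambda>_. normal_law \<sigma>))
    = ennreal (exp (\<sigma>\<^sup>2 / 2 * (\<Sum>i\<in>I. (a i)\<^sup>2)))"
proof -
  interpret product_sigma_finite "\<lambda>_. normal_law \<sigma>"
    using assms(2) by (rule product_sigma_finite_normal)
  have "(\<integral>\<^sup>+x. ennreal (exp (\<Sum>i\<in>I. a i * x i)) \<partial>PiM I (\<lambda>_. normal_law \<sigma>))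
      = (\<integral>\<^sup>+x. (\<Prod>i\<in>I. ennreal (exp (a i * x i))) \<partial>PiM I (\<lambda>_. normal_law \<sigma>))"
    using assms(1) by (simp add: exp_sum prod_ennreal)
  also have "\<dots> = (\<Prod>i\<in>I. ennreal (exp (\<sigma>\<^sup>2 / 2 * (a i)\<^sup>2)))"
    using assms by (subst product_nn_integral_prod) (simp_all add: normal_exp_linear)
  also have "\<dots> = ennreal (exp (\<sigma>\<^sup>2 / 2 * (\<Sum>i\<in>I. (a i)\<^sup>2)))"
    using assms(1) by (simp add: sum_distrib_left exp_sum prod_ennreal)
  finally show ?thesis .
qed

text \<open>The coefficients of the noise along an orthonormal system are independent normal variables, but the
proof avoids a change of coordinates.  It linearizes each square by an independent standard normal
variable g, using \<open>exp (t^2 / 2) = E (exp (t * g))\<close>, and integrates over the noise first.  This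
gives \<open>exp (c * |\<Sum>u. g u * u|^2)\<close>, and by orthonormality the norm is
\<open>\<Sum>u. (g u)^2\<close>, so that the remaining integral is a product of one-dimensional ones.\<close>

lemma gaussian_exp_projection:
  assumes "orthonormal n U" "0 \<le> c" "2 * c < 1" "0 < \<sigma>"
  shows "(\<integral>\<^sup>+\<xi>. ennreal (exp (c / \<sigma>\<^sup>2 * (\<Sum>u\<in>U. (vinner n u \<xi>)\<^sup>2))) \<partial>gaussian n \<sigma>)
    = ennreal ((1 / sqrt (1 - 2 * c)) ^ card U)"
proof -
  have fin: "finite U" using assms(1) by (simp add: orthonormal_def)
  define s where "s = sqrt (2 * c) / \<sigma>"
  have s: "s\<^sup>2 = 2 * (c / \<sigma>\<^sup>2)" "\<sigma>\<^sup>2 / 2 * s\<^sup>2 = c"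
    using assms by (auto simp: s_def power_divide field_simps)
  let ?G = "PiM U (\<lambda>_. normal_law 1)"
  interpret I: product_sigma_finite "\<lambda>_::nat. normal_law \<sigma>"
    using assms(4) by (rule product_sigma_finite_normal)
  interpret U: product_sigma_finite "\<lambda>_::nat \<Rightarrow> real. normal_law 1"
    by (rule product_sigma_finite_normal) simp
  have sI: "sigma_finite_measure (gaussian n \<sigma>)"
    unfolding gaussian_def by (rule I.sigma_finite) simp
  have sU: "sigma_finite_measure ?G"
    using fin by (rule U.sigma_finite)
  interpret P: pair_sigma_finite "gaussian n \<sigma>" ?G
    using sI sU by (simp add: pair_sigma_finite_def)
  have "(\<integral>\<^sup>+\<xi>. ennreal (exp (c / \<sigma>\<^sup>2 * (\<Sum>u\<in>U. (vinner n u \<xi>)\<^sup>2))) \<partial>gaussian n \<sigma>)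
      = (\<integral>\<^sup>+\<xi>. \<integral>\<^sup>+g. ennreal (exp (\<Sum>u\<in>U. (s * vinner n u \<xi>) * g u)) \<partial>?G \<partial>gaussian n \<sigma>)"
    by (subst product_normal_exp_linear[OF fin])
       (simp_all add: power_mult_distrib s(1) mult.assoc sum_divide_distrib sum_distrib_left)
  \<comment> \<open>Tonelli: exchange the noise and the auxiliary variables.\<close>
  also have "\<dots> = (\<integral>\<^sup>+g. \<integral>\<^sup>+\<xi>. ennreal (exp (\<Sum>u\<in>U. (s * vinner n u \<xi>) * g u)) \<partial>gaussian n \<sigma> \<partial>?G)"
    unfolding vinner_def gaussian_def
    by (rule P.Fubini'[unfolded gaussian_def, symmetric]) measurable
  also have "\<dots> = (\<integral>\<^sup>+g. ennreal (exp (c * (\<Sum>u\<in>U. (g u)\<^sup>2))) \<partial>?G)"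
  proof (rule nn_integral_cong)
    fix g
    let ?a = "lin_comb n U g (\<lambda>u. u)"
    have "(\<Sum>u\<in>U. (s * vinner n u \<xi>) * g u) = (\<Sum>i\<in>{1..n}. s * ?a i * \<xi> i)" for \<xi>
    proof -
      have "(\<Sum>u\<in>U. (s * vinner n u \<xi>) * g u) = s * vinner n ?a \<xi>"
        by (simp add: vinner_simps sum_distrib_left mult_ac)
      then show ?thesis by (simp add: vinner_def sum_distrib_left mult.assoc)
    qed
    then have "(\<integral>\<^sup>+\<xi>. ennreal (exp (\<Sum>u\<in>U. (s * vinner n u \<xi>) * g u)) \<partial>gaussian n \<sigma>)
        = ennreal (exp (\<sigma>\<^sup>2 / 2 * (\<Sum>i\<in>{1..n}. (s * ?a i)\<^sup>2)))"
      unfolding gaussian_def using assms(4) by (simp only: product_normal_exp_linear finite_atLeastAtMost)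
    also have "\<sigma>\<^sup>2 / 2 * (\<Sum>i\<in>{1..n}. (s * ?a i)\<^sup>2) = (\<sigma>\<^sup>2 / 2 * s\<^sup>2) * vinner n ?a ?a"
      unfolding vinner_def sum_distrib_left by (intro sum.cong) (simp_all add: power2_eq_square)
    also have "\<dots> = c * (\<Sum>u\<in>U. (g u)\<^sup>2)"
      by (simp only: s(2) orthonormal_norm[OF assms(1)])
    finally show "(\<integral>\<^sup>+\<xi>. ennreal (exp (\<Sum>u\<in>U. (s * vinner n u \<xi>) * g u)) \<partial>gaussian n \<sigma>)
        = ennreal (exp (c * (\<Sum>u\<in>U. (g u)\<^sup>2)))" .
  qed
  also have "\<dots> = (\<integral>\<^sup>+g. (\<Prod>u\<in>U. ennreal (exp (c * (g u)\<^sup>2))) \<partial>?G)"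
    using fin by (simp add: exp_sum prod_ennreal sum_distrib_left)
  also have "\<dots> = (\<Prod>u\<in>U. ennreal (1 / sqrt (1 - 2 * c)))"
    using fin assms by (subst U.product_nn_integral_prod) (simp_all add: normal_exp_square)
  also have "\<dots> = ennreal ((1 / sqrt (1 - 2 * c)) ^ card U)"
    using assms by (simp add: ennreal_power)
  finally show ?thesis .
qed

text \<open>The value 3/20 is 3 (the factor of the projected noise in \<open>noise_absorption\<close>) divided by 20
(the temperature), and 1/5 is the penalty factor 4 divided by 20.  The aggregation scheme works because
\<open>1 / sqrt (1 - 2 * (3 / 20)) \<le> exp (1 / 5)\<close>.\<close>

lemma gaussian_exp_projection_bound:
  assumes "orthonormal n U" "0 < \<sigma>"
  shows "(\<integral>\<^sup>+\<xi>. ennreal (exp (3 / 20 / \<sigma>\<^sup>2 * (\<Sum>u\<in>U. (vinner n u \<xi>)\<^sup>2))) \<partial>gaussian n \<sigma>)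
    \<le> ennreal (exp (real (card U) / 5))"
proof -
  have "1 / sqrt (1 - 2 * (3/20)) \<le> exp (1 / 5 :: real)"
  proof -
    have "sqrt (10 / 7) \<le> sqrt ((exp (1 / 5))\<^sup>2 :: real)"
    proof (rule real_sqrt_le_mono)
      \<comment> \<open>The claim is equivalent to \<open>10 / 7 \<le> exp (2 / 5)\<close>; two terms of the series after 1 suffice.\<close>
      have "(10::real) / 7 \<le> 1 + 2/5 + (2/5)\<^sup>2 / 2" by (simp add: power2_eq_square)
      also have "\<dots> \<le> exp (2/5)" by (rule exp_lower_Taylor_quadratic) simp
      also have "\<dots> = (exp (1 / 5))\<^sup>2" by (simp flip: exp_double)
      finally show "(10::real) / 7 \<le> (exp (1 / 5))\<^sup>2" .
    qed
    then show ?thesis by (simp add: real_sqrt_divide)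
  qed
  then have "(1 / sqrt (1 - 2 * (3/20))) ^ card U \<le> exp (1 / 5 :: real) ^ card U"
    by (intro power_mono) auto
  also have "\<dots> = exp (real (card U) / 5)"
    by (simp flip: exp_of_nat_mult)
  finally show ?thesis
    using gaussian_exp_projection[OF assms(1) _ _ assms(2), of "3/20"] by (simp add: ennreal_leI)
qed

section \<open>Entropy and the prior\<close>

text \<open>Convexity of \<open>x * ln x\<close> in the form of a tangent inequality.  The form holds for a = 0 as well,
which makes it usable at the boundary of the simplex.\<close>

lemma entropy_tangent:
  assumes "0 \<le> a" "0 < (b::real)"
  shows "a - b \<le> a * ln (a / b)"
proof (cases "a = 0")
  case False
  then have a: "0 < a" using assms by simp
  have "ln (b / a) \<le> b / a - 1" using a assms by (intro ln_le_minus_one) simp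
  then have "a * ln (b / a) \<le> b - a" using a by (simp add: field_simps)
  moreover have "ln (b / a) = - ln (a / b)" using a assms by (simp add: ln_div)
  ultimately show ?thesis by simp
qed (use assms in simp)

text \<open>Nonnegativity of the divergence of w from the Gibbs measure proportional to
\<open>\<pi> k * exp (h k / t)\<close>.\<close>

lemma gibbs_variational:
  fixes w \<pi> h :: "'a \<Rightarrow> real"
  assumes "finite S" "S \<noteq> {}" "\<And>k. k \<in> S \<Longrightarrow> 0 \<le> w k" "(\<Sum>k\<in>S. w k) = 1"
    "\<And>k. k \<in> S \<Longrightarrow> 0 < \<pi> k" "0 < t"
  shows "(\<Sum>k\<in>S. w k * h k) - t * (\<Sum>k\<in>S. w k * ln (w k / \<pi> k)) \<le> t * ln (\<Sum>k\<in>S. \<pi> k * exp (h k / t))"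
proof -
  define Z where "Z = (\<Sum>k\<in>S. \<pi> k * exp (h k / t))"
  have Z: "Z > 0" unfolding Z_def using assms by (intro sum_pos) auto
  have "0 = (\<Sum>k\<in>S. w k - \<pi> k * exp (h k / t) / Z)"
    using Z by (simp add: sum_subtractf assms(4) flip: sum_divide_distrib Z_def)
  also have "\<dots> \<le> (\<Sum>k\<in>S. w k * ln (w k / \<pi> k) - w k * h k / t + w k * ln Z)"
  proof (rule sum_mono)
    fix k assume k: "k \<in> S"
    have "w k - \<pi> k * exp (h k / t) / Z \<le> w k * ln (w k / (\<pi> k * exp (h k / t) / Z))"
      using assms(3,5)[OF k] Z by (intro entropy_tangent) auto
    also have "\<dots> = w k * ln (w k / \<pi> k) - w k * h k / t + w k * ln Z"
    proof (cases "w k = 0")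
      case False
      then have "0 < w k" using assms(3)[OF k] by simp
      then show ?thesis using assms(5)[OF k] Z by (simp add: ln_div ln_mult algebra_simps)
    qed simp
    finally show "w k - \<pi> k * exp (h k / t) / Z \<le> w k * ln (w k / \<pi> k) - w k * h k / t + w k * ln Z" .
  qed
  also have "\<dots> = (\<Sum>k\<in>S. w k * ln (w k / \<pi> k)) - (\<Sum>k\<in>S. w k * h k) / t + ln Z"
    by (simp add: sum.distrib sum_subtractf sum_divide_distrib assms(4) flip: sum_distrib_right)
  finally show ?thesis using assms(6) unfolding Z_def[symmetric] by (simp add: field_simps)
qed

lemma prior_weight_pos: "J \<subseteq> {1..M} \<Longrightarrow> 0 < prior_weight M J"
  using card_mono[of "{1..M}" J] by (simp add: prior_weight_def)

lemma prior_pos: "J \<subseteq> {1..M} \<Longrightarrow> 0 < prior M J"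
  unfolding prior_def by (intro divide_pos_pos sum_pos) (auto intro: prior_weight_pos)

lemma prior_sum: "(\<Sum>J\<in>Pow {1..M}. prior M J) = 1"
proof -
  have "0 < (\<Sum>J\<in>Pow {1..M}. prior_weight M J)" 
    by (intro sum_pos) (auto intro: prior_weight_pos)
  then show ?thesis by (simp add: prior_def flip: sum_divide_distrib)
qed

lemma prob_vectorsD:
  assumes "w \<in> prob_vectors M"
  shows "\<And>J. J \<subseteq> {1..M} \<Longrightarrow> 0 \<le> w J" "(\<Sum>J\<in>Pow {1..M}. w J) = 1"
  using assms by (auto simp: prob_vectors_def)

section \<open>The minimizer of the criterion\<close>

definition mix :: "nat \<Rightarrow> real \<Rightarrow> (nat set \<Rightarrow> real) \<Rightarrow> (nat set \<Rightarrow> real) \<Rightarrow> (nat set \<Rightarrow> real)" where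
  "mix M t w v = (\<lambda>J\<in>Pow {1..M}. (1 - t) * w J + t * v J)"

lemma mix_prob_vectors:
  assumes "w \<in> prob_vectors M" "v \<in> prob_vectors M" "0 \<le> t" "t \<le> 1"
  shows "mix M t w v \<in> prob_vectors M"
  using prob_vectorsD[OF assms(1)] prob_vectorsD[OF assms(2)] assms(3,4)
  by (auto simp: prob_vectors_def mix_def sum.distrib simp flip: sum_distrib_left)

text \<open>The tangent inequality at the mixture, applied to w and to v; the linear terms cancel because all
three weight vectors have the same total mass.\<close>

lemma KL_convex:
  assumes "w \<in> prob_vectors M" "v \<in> prob_vectors M" "0 < t" "t < 1"
  shows "KL M (mix M t w v) \<le> (1 - t) * KL M w + t * KL M v"
proof -
  let ?p = "\<lambda>J. (1 - t) * w J + t * v J"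
  note w = prob_vectorsD[OF assms(1)] and v = prob_vectorsD[OF assms(2)]
  have tan: "a * ln (p / b) + a - p \<le> a * ln (a / b)" if "0 \<le> a" "0 \<le> p" "p = 0 \<Longrightarrow> a = 0" "0 < b" for a p b :: real
  proof (cases "a = 0")
    case False
    then have "0 < a" "0 < p" using that by (auto simp: less_le)
    then show ?thesis using entropy_tangent[of a p] that(4) by (simp add: ln_div algebra_simps)
  qed (use that in simp)
  have "KL M (mix M t w v) = (\<Sum>J\<in>Pow {1..M}. ?p J * ln (?p J / prior M J))"
    unfolding KL_def by (intro sum.cong) (auto simp: mix_def)
  also have "\<dots> \<le> (\<Sum>J\<in>Pow {1..M}. (1 - t) * (w J * ln (w J / prior M J) - w J + ?p J)
      + t * (v J * ln (v J / prior M J) - v J + ?p J))"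
  proof (rule sum_mono)
    fix J assume "J \<in> Pow {1..M}"
    then have J: "0 \<le> w J" "0 \<le> v J" "0 < prior M J"
      using w(1) v(1) prior_pos by auto
    have p: "0 \<le> ?p J" "?p J = 0 \<Longrightarrow> w J = 0" "?p J = 0 \<Longrightarrow> v J = 0"
      using J assms(3,4) by (auto simp: add_nonneg_eq_0_iff)
    have "(1 - t) * (w J * ln (?p J / prior M J)) \<le> (1 - t) * (w J * ln (w J / prior M J) - w J + ?p J)"
      using tan[of "w J" "?p J" "prior M J"] J p assms(4) by (intro mult_left_mono) auto
    moreover have "t * (v J * ln (?p J / prior M J)) \<le> t * (v J * ln (v J / prior M J) - v J + ?p J)"
      using tan[of "v J" "?p J" "prior M J"] J p assms(3) by (intro mult_left_mono) auto
    ultimately show "?p J * ln (?p J / prior M J) \<le> (1 - t) * (w J * ln (w J / prior M J) - w J + ?p J)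
      + t * (v J * ln (v J / prior M J) - v J + ?p J)"
      by (simp add: algebra_simps)
  qed
  also have "\<dots> = (1 - t) * KL M w + t * KL M v"
    using w(2) v(2)
    by (simp add: KL_def sum.distrib sum_subtractf flip: sum_distrib_left)
  finally show ?thesis .
qed

lemma aggregate_mix:
  assumes "i \<in> {1..n}"
  shows "aggregate n M \<mu>s Y (mix M t w v) i = (1 - t) * aggregate n M \<mu>s Y w i + t * aggregate n M \<mu>s Y v i"
  using assms
  by (simp add: aggregate_def lin_comb_apply mix_def sum_distrib_left algebra_simps sum.distrib sum_subtractf)

lemma enorm_convex_combination:
  assumes "\<And>i. i \<in> {1..n} \<Longrightarrow> p i = (1 - t) * a i + t * b i"
  shows "(enorm n (vdiff n y p))\<^sup>2 = (1 - t) * (enorm n (vdiff n y a))\<^sup>2 + t * (enorm n (vdiff n y b))\<^sup>2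
    - t * (1 - t) * (enorm n (vdiff n a b))\<^sup>2"
  unfolding enorm_sq vinner_def sum_distrib_left sum.distrib[symmetric] sum_subtractf[symmetric]
  by (intro sum.cong) (simp_all add: vdiff_def assms algebra_simps)

text \<open>Only the squared norm of the residual of the aggregate contributes to the curvature; the average
loss and the penalty are linear, the entropy term is convex.\<close>

lemma Q_crit_strongly_convex:
  assumes "w \<in> prob_vectors M" "v \<in> prob_vectors M" "0 < t" "t < 1" "0 \<le> \<kappa>"
  shows "Q_crit n M \<sigma> \<nu> \<kappa> \<mu>s Y (mix M t w v)
    \<le> (1 - t) * Q_crit n M \<sigma> \<nu> \<kappa> \<mu>s Y w + t * Q_crit n M \<sigma> \<nu> \<kappa> \<mu>s Y v
      - (1 - \<nu>) * (t * (1 - t) * (enorm n (vdiff n (aggregate n M \<mu>s Y w) (aggregate n M \<mu>s Y v)))\<^sup>2)"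
proof -
  have lin: "(\<Sum>J\<in>Pow {1..M}. mix M t w v J * g J) =
      (1 - t) * (\<Sum>J\<in>Pow {1..M}. w J * g J) + t * (\<Sum>J\<in>Pow {1..M}. v J * g J)" for g
    by (simp add: mix_def sum_distrib_left algebra_simps sum.distrib sum_subtractf)
  have "\<kappa> * KL M (mix M t w v) \<le> \<kappa> * ((1 - t) * KL M w + t * KL M v)"
    using KL_convex[OF assms(1-4)] assms(5) by (rule mult_left_mono)
  moreover have e: "(enorm n (vdiff n Y (aggregate n M \<mu>s Y (mix M t w v))))\<^sup>2
    = (1 - t) * (enorm n (vdiff n Y (aggregate n M \<mu>s Y w)))\<^sup>2
      + t * (enorm n (vdiff n Y (aggregate n M \<mu>s Y v)))\<^sup>2
      - t * (1 - t) * (enorm n (vdiff n (aggregate n M \<mu>s Y w) (aggregate n M \<mu>s Y v)))\<^sup>2"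
    by (rule enorm_convex_combination) (rule aggregate_mix)
  ultimately show ?thesis
    unfolding Q_crit_def lin e by (simp add: algebra_simps)
qed

text \<open>At 0 the function is squeezed between two functions that vanish there; both bounds come from
\<open>ln y \<le> y - 1\<close>, the lower one with y a square root.\<close>

lemma continuous_on_x_ln_x:
  assumes "0 < (b::real)"
  shows "continuous_on {0..} (\<lambda>x. x * ln (x / b))"
  unfolding continuous_on
proof
  fix x :: real assume "x \<in> {0..}"
  show "((\<lambda>x. x * ln (x / b)) \<longlongrightarrow> x * ln (x / b)) (at x within {0..})"
  proof (cases "x = 0")
    case False
    then have "x > 0" using \<open>x \<in> {0..}\<close> by simp
    then show ?thesis using assms by (intro tendsto_intros) auto
  next
    case True
    \<comment> \<open>Tangent inequality at \<open>sqrt (b * x)\<close>, the geometric mean of x and b.\<close>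
    have low: "2 * (x - sqrt (b * x)) \<le> x * ln (x / b)" if "x \<ge> 0" for x
    proof (cases "x = 0")
      case False
      then have x: "x > 0" using that by simp
      have "x - sqrt (b * x) \<le> x * ln (x / sqrt (b * x))"
        using x assms by (intro entropy_tangent) auto
      also have "ln (x / sqrt (b * x)) = ln (x / b) / 2"
        using x assms by (simp add: ln_div ln_mult ln_sqrt field_simps)
      finally show ?thesis by simp
    qed simp
    have up: "x * ln (x / b) \<le> x * (x / b - 1)" if "x \<ge> 0" for x
    proof (cases "x = 0")
      case False
      then show ?thesis using that assms by (intro mult_left_mono ln_le_minus_one) auto
    qed simp
    have "((\<lambda>x. 2 * (x - sqrt (b * x))) \<longlongrightarrow> 2 * (0 - sqrt (b * 0))) (at 0 within {0..})"
      by (intro tendsto_intros)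
    moreover have "((\<lambda>x. x * (x / b - 1)) \<longlongrightarrow> 0 * (0 / b - 1)) (at 0 within {0..})"
      using assms by (intro tendsto_intros) auto
    moreover have "\<forall>\<^sub>F x in at 0 within {0..}. 2 * (x - sqrt (b * x)) \<le> x * ln (x / b)"
      "\<forall>\<^sub>F x in at 0 within {0..}. x * ln (x / b) \<le> x * (x / b - 1)"
      unfolding eventually_at_filter using low up by (auto intro!: always_eventually)
    ultimately have "((\<lambda>x. x * ln (x / b)) \<longlongrightarrow> 0) (at 0 within {0..})"
      by (intro tendsto_sandwich[of "\<lambda>x. 2 * (x - sqrt (b * x))" "\<lambda>x. x * ln (x / b)" _ "\<lambda>x. x * (x / b - 1)"]) simp_all
    then show ?thesis using True by simp
  qed
qed

lemma continuous_on_coordinate: "continuous_on S (\<lambda>w :: 'a \<Rightarrow> real. w j)"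
  by (rule continuous_on_subset[OF continuous_on_product_coordinates subset_UNIV])

text \<open>Weight vectors have the value \<open>undefined\<close> outside the index family, so the simplex is a closed
subset of a full product in which these factors are singletons, and the product theorem for compact
spaces applies.\<close>

lemma compact_prob_vectors: "compact (prob_vectors M)"
proof -
  let ?S = "\<lambda>J. if J \<in> Pow {1..M} then {0..1::real} else {undefined}"
  have "compactin (product_topology (\<lambda>_. euclidean) UNIV) (PiE UNIV ?S)"
    unfolding compactin_PiE by (intro disjI2 ballI) (simp split: if_split)
  then have "compact (PiE UNIV ?S)"
    by (simp add: euclidean_product_topology)
  moreover have "closed {w :: nat set \<Rightarrow> real. (\<Sum>J\<in>Pow {1..M}. w J) = 1}"
    by (intro closed_Collect_eq continuous_intros continuous_on_coordinate)
  ultimately have "compact (PiE UNIV ?S \<inter> {w. (\<Sum>J\<in>Pow {1..M}. w J) = 1})"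
    by (rule compact_Int_closed)
  also have "PiE UNIV ?S \<inter> {w. (\<Sum>J\<in>Pow {1..M}. w J) = 1} = prob_vectors M"
  proof (intro set_eqI iffI)
    fix w assume w: "w \<in> prob_vectors M"
    have "w J \<le> 1" if "J \<in> Pow {1..M}" for J
      using member_le_sum[of J "Pow {1..M}" w] prob_vectorsD[OF w] that by auto
    then show "w \<in> PiE UNIV ?S \<inter> {w. (\<Sum>J\<in>Pow {1..M}. w J) = 1}"
      using w by (auto simp: prob_vectors_def PiE_iff extensional_def)
  next
    fix w assume w: "w \<in> PiE UNIV ?S \<inter> {w. (\<Sum>J\<in>Pow {1..M}. w J) = 1}"
    then have "w J \<in> ?S J" for J by (auto simp: PiE_iff)
    from this have "\<And>J. J \<in> Pow {1..M} \<Longrightarrow> 0 \<le> w J" "\<And>J. J \<notin> Pow {1..M} \<Longrightarrow> w J = undefined"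
      by (metis atLeastAtMost_iff, metis singletonD)
    then show "w \<in> prob_vectors M"
      using w by (auto simp: prob_vectors_def PiE_iff extensional_def)
  qed
  finally show ?thesis .
qed

lemma continuous_on_KL: "continuous_on (prob_vectors M) (KL M)"
proof -
  have "continuous_on (prob_vectors M) (\<lambda>w. w J * ln (w J / prior M J))" if "J \<in> Pow {1..M}" for J
    using that prob_vectorsD(1)
    by (intro continuous_on_compose2[OF continuous_on_x_ln_x[of "prior M J"]]
          continuous_on_coordinate prior_pos) auto
  then show ?thesis unfolding KL_def[abs_def] by (intro continuous_on_sum)
qed

lemma continuous_on_Q_crit: "continuous_on (prob_vectors M) (Q_crit n M \<sigma> \<nu> \<kappa> \<mu>s Y)"
proof -
  have agg: "(enorm n (vdiff n Y (aggregate n M \<mu>s Y w)))\<^sup>2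
      = (\<Sum>i\<in>{1..n}. (Y i - (\<Sum>J\<in>Pow {1..M}. w J * proj n \<mu>s J Y i))\<^sup>2)" for w
    unfolding enorm_sq vinner_def
    by (intro sum.cong) (simp_all add: vdiff_def aggregate_def lin_comb_apply power2_eq_square)
  show ?thesis unfolding Q_crit_def[abs_def] agg
    by (intro continuous_intros continuous_on_KL continuous_on_coordinate)
qed

definition point_mass :: "nat \<Rightarrow> nat set \<Rightarrow> (nat set \<Rightarrow> real)" where
  "point_mass M J = (\<lambda>K\<in>Pow {1..M}. if K = J then 1 else 0)"

lemma sum_point_mass: "J \<subseteq> {1..M} \<Longrightarrow> (\<Sum>K\<in>Pow {1..M}. point_mass M J K * g K) = g J"
proof -
  assume J: "J \<subseteq> {1..M}"
  have "(\<Sum>K\<in>Pow {1..M}. point_mass M J K * g K) = (\<Sum>K\<in>Pow {1..M}. if J = K then g K else 0)"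
    by (intro sum.cong) (auto simp: point_mass_def)
  then show ?thesis using J by simp
qed

lemma point_mass_prob_vectors: "J \<subseteq> {1..M} \<Longrightarrow> point_mass M J \<in> prob_vectors M"
  using sum_point_mass[of J M "\<lambda>_. 1"] unfolding prob_vectors_def
  by (intro CollectI conjI ballI) (simp_all add: point_mass_def)

lemma Q_crit_minimizer:
  assumes w_def: "w = arg_min_on (Q_crit n M \<sigma> \<nu> \<kappa> \<mu>s Y) (prob_vectors M)"
  shows "w \<in> prob_vectors M"
    and "v \<in> prob_vectors M \<Longrightarrow> Q_crit n M \<sigma> \<nu> \<kappa> \<mu>s Y w \<le> Q_crit n M \<sigma> \<nu> \<kappa> \<mu>s Y v"
proof -
  let ?Q = "Q_crit n M \<sigma> \<nu> \<kappa> \<mu>s Y"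
  obtain u where "u \<in> prob_vectors M" "\<forall>v\<in>prob_vectors M. ?Q u \<le> ?Q v"
    using continuous_attains_inf[OF compact_prob_vectors _ continuous_on_Q_crit]
      point_mass_prob_vectors[of "{}"] by blast
  then have "is_arg_min ?Q (\<lambda>x. x \<in> prob_vectors M) u"
    by (auto simp: is_arg_min_linorder)
  then have "is_arg_min ?Q (\<lambda>x. x \<in> prob_vectors M) w"
    unfolding w_def arg_min_on_def arg_min_def by (rule someI[of "is_arg_min ?Q (\<lambda>x. x \<in> prob_vectors M)"])
  then show "w \<in> prob_vectors M" "v \<in> prob_vectors M \<Longrightarrow> ?Q w \<le> ?Q v"
    by (auto simp: is_arg_min_linorder)
qed

text \<open>Compare the minimizer with its mixtures \<open>(1 - t) w + t v\<close>, divide the strong convexity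
inequality by t, and let t tend to 0.\<close>

lemma Q_crit_minimizer_strong:
  assumes "v \<in> prob_vectors M" "0 \<le> \<kappa>"
    and w_def: "w = arg_min_on (Q_crit n M \<sigma> \<nu> \<kappa> \<mu>s Y) (prob_vectors M)"
  shows "Q_crit n M \<sigma> \<nu> \<kappa> \<mu>s Y w
     + (1 - \<nu>) * (enorm n (vdiff n (aggregate n M \<mu>s Y w) (aggregate n M \<mu>s Y v)))\<^sup>2
    \<le> Q_crit n M \<sigma> \<nu> \<kappa> \<mu>s Y v"
proof -
  let ?Q = "Q_crit n M \<sigma> \<nu> \<kappa> \<mu>s Y"
  define d where "d = (1 - \<nu>) * (enorm n (vdiff n (aggregate n M \<mu>s Y w) (aggregate n M \<mu>s Y v)))\<^sup>2"
  have w: "w \<in> prob_vectors M" using w_def by (rule Q_crit_minimizer)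
  have "?Q w + (1 - t) * d \<le> ?Q v" if t: "0 < t" "t < 1" for t
  proof -
    have "?Q w \<le> ?Q (mix M t w v)"
      using w assms(1) t by (intro Q_crit_minimizer[OF w_def] mix_prob_vectors) auto
    also have "\<dots> \<le> (1 - t) * ?Q w + t * ?Q v - t * ((1 - t) * d)"
      using Q_crit_strongly_convex[OF w assms(1) t assms(2)] by (simp add: d_def algebra_simps)
    finally have "t * (?Q w + (1 - t) * d) \<le> t * ?Q v" by (simp add: algebra_simps)
    then show ?thesis using t by simp
  qed
  then have "\<forall>\<^sub>F t in at_right 0. ?Q w + (1 - t) * d \<le> ?Q v"
    by (auto simp: eventually_at_right_field intro!: exI[of _ 1])
  moreover have "((\<lambda>t. ?Q w + (1 - t) * d) \<longlongrightarrow> ?Q w + (1 - 0) * d) (at_right 0)"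
    by (intro tendsto_intros)
  ultimately have "?Q w + (1 - 0) * d \<le> ?Q v"
    by (intro tendsto_upperbound) auto
  then show ?thesis by (simp add: d_def)
qed

section \<open>A deterministic risk bound\<close>

text \<open>The vector u lies in the span indexed by \<open>K \<union> J\<close>, hence only the projection p of the noise
on this span is seen, and \<open>2 <p, u> - 1/2 |u|^2 \<le> 2 |p|^2\<close>.  The projection on the smaller
span of J costs at most one more \<open>|p|^2\<close>.\<close>

lemma noise_absorption:
  assumes "finite J" "finite K"
    and p_def: "p = proj n \<mu>s (K \<union> J) \<xi>"
    and u_def: "u = vdiff n (proj n \<mu>s K Y) (proj n \<mu>s J Y)"
  shows "2 * vinner n \<xi> u - 1/2 * vinner n u u + vinner n (proj n \<mu>s J \<xi>) (proj n \<mu>s J \<xi>)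
    \<le> 3 * vinner n p p"
proof -
  let ?q = "proj n \<mu>s J \<xi>"
  have fin: "finite (K \<union> J)" using assms by simp
  have sub: "fspan n \<mu>s K \<subseteq> fspan n \<mu>s (K \<union> J)" "fspan n \<mu>s J \<subseteq> fspan n \<mu>s (K \<union> J)"
    by (rule fspan_mono[OF fin], simp)+
  have "u \<in> fspan n \<mu>s (K \<union> J)"
    unfolding u_def using sub proj_in_fspan[OF assms(1)] proj_in_fspan[OF assms(2)]
    by (intro vdiff_mem_fspan) auto
  then have "vinner n p u = vinner n \<xi> u" unfolding p_def by (rule proj_inner[OF fin])
  moreover have "0 \<le> vinner n (vdiff n p (lin_comb n {u} (\<lambda>_. 1/2) (\<lambda>u. u))) (vdiff n p (lin_comb n {u} (\<lambda>_. 1/2) (\<lambda>u. u)))"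
    by (rule vinner_nonneg)
  ultimately have 1: "2 * vinner n \<xi> u - 1/2 * vinner n u u \<le> 2 * vinner n p p"
    by (simp add: vinner_simps vinner_commute[of n u p])
  have "?q \<in> fspan n \<mu>s (K \<union> J)" using sub proj_in_fspan[OF assms(1)] by auto
  then have "vinner n p ?q = vinner n ?q ?q"
    unfolding p_def using proj_inner[OF fin] proj_inner[OF assms(1) proj_in_fspan[OF assms(1)]] by metis
  then have "vinner n ?q ?q \<le> vinner n p p"
    using vinner_nonneg[of n "vdiff n p ?q"] by (simp add: vinner_simps vinner_commute[of n ?q p])
  then show ?thesis using 1 by simp
qed

text \<open>The bias lies in the orthogonal complement of the span, the projected noise in the span.\<close>

lemma proj_risk:
  assumes "finite J" and f_def: "f = proj n \<mu>s J (vadd n \<mu> \<xi>)"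
  shows "(enorm n (vdiff n f \<mu>))\<^sup>2
    = (enorm n (vdiff n (proj n \<mu>s J \<mu>) \<mu>))\<^sup>2 + vinner n (proj n \<mu>s J \<xi>) (proj n \<mu>s J \<xi>)"
proof -
  let ?a = "proj n \<mu>s J \<mu>" and ?q = "proj n \<mu>s J \<xi>"
  have "vinner n (vdiff n f \<mu>) (vdiff n f \<mu>) = vinner n (vadd n (vdiff n ?a \<mu>) ?q) (vadd n (vdiff n ?a \<mu>) ?q)"
    using proj_vadd[OF assms(1), of _ n \<mu>s \<mu> \<xi>]
    by (intro vinner_cong) (auto simp: vdiff_def vadd_def f_def)
  also have "\<dots> = vinner n (vdiff n ?a \<mu>) (vdiff n ?a \<mu>) + vinner n ?q ?q"
    using proj_inner[OF assms(1) proj_in_fspan[OF assms(1)], where y = \<mu> and y1 = \<xi> and \<mu>s = \<mu>s and n = n]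
    by (simp add: vinner_simps vinner_commute)
  finally show ?thesis by (simp only: enorm_sq)
qed

text \<open>Optimality against the point mass at J gives, with
\<open>N\<close> the w-average of
\<open>2 <\<xi>, f_K - f_J> - 1/2 |f_K - f_J|^2 + |A_J \<xi>|^2\<close>, a bound for the risk by bias, penalty
and prior of J plus \<open>N\<close> minus the penalty and the entropy of w.  The identity behind this uses
\<nu> = 1/2: half of the spread of the f_K around f_w and half of \<open>|f_w - f_J|^2\<close> combine
to half of the spread around f_J.\<close>

lemma estimator_bound:
  assumes "0 < \<sigma>" "J \<subseteq> {1..M}"
    and est_def: "est = Q_estimator n M \<sigma> (1/2) (20 * \<sigma>\<^sup>2) \<mu>s (vadd n \<mu> \<xi>)"
    and p_def: "p = (\<lambda>K. proj n \<mu>s (K \<union> J) \<xi>)"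
  shows "(enorm n (vdiff n est \<mu>))\<^sup>2 \<le> (enorm n (vdiff n (proj n \<mu>s J \<mu>) \<mu>))\<^sup>2
     + 4 * \<sigma>\<^sup>2 * real (card J) + 20 * \<sigma>\<^sup>2 * ln (1 / prior M J)
     + 20 * \<sigma>\<^sup>2 * ln (\<Sum>K\<in>Pow {1..M}. prior M K *
          exp (3 / 20 / \<sigma>\<^sup>2 * vinner n (p K) (p K) - trace_op n (proj n \<mu>s K) / 5))"
proof -
  define Y where "Y = vadd n \<mu> \<xi>"
  let ?S = "Pow {1..M}" and ?L = "20 * \<sigma>\<^sup>2"
  define w where "w = arg_min_on (Q_crit n M \<sigma> (1/2) ?L \<mu>s Y) (prob_vectors M)"
  define f where "f K = proj n \<mu>s K Y" for K
  define q where "q = vinner n (proj n \<mu>s J \<xi>) (proj n \<mu>s J \<xi>)"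
  let ?C = "\<lambda>K. 4 * \<sigma>\<^sup>2 * trace_op n (proj n \<mu>s K)"
  have est: "est = aggregate n M \<mu>s Y w" by (simp add: est_def Q_estimator_def Y_def w_def)
  have w_in: "w \<in> prob_vectors M" using w_def by (rule Q_crit_minimizer)
  note w = prob_vectorsD[OF w_in]
  have finJ: "finite J" using assms(2) finite_subset by blast
  have finK: "finite K" if "K \<in> ?S" for K using that finite_subset by auto
  have aggJ: "aggregate n M \<mu>s Y (point_mass M J) = f J"
    unfolding aggregate_def f_def
  proof (rule fspan_eqI)
    show "lin_comb n ?S (point_mass M J) (\<lambda>K. proj n \<mu>s K Y) \<in> fspan n \<mu>s {1..M}"
    proof (rule lin_comb_mem_fspan)
      fix K assume K: "K \<in> ?S"
      show "proj n \<mu>s K Y \<in> fspan n \<mu>s {1..M}"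
        using fspan_mono[of "{1..M}" K n \<mu>s] proj_in_fspan[OF finK[OF K], of n \<mu>s Y] K by auto
    qed
    show "proj n \<mu>s J Y \<in> fspan n \<mu>s J" by (rule proj_in_fspan[OF finJ])
  qed (simp add: lin_comb_apply sum_point_mass[OF assms(2)])
  have QJ: "Q_crit n M \<sigma> (1/2) ?L \<mu>s Y (point_mass M J)
      = vinner n (vdiff n Y (f J)) (vdiff n Y (f J)) + ?C J + ?L * ln (1 / prior M J)"
  proof -
    have "KL M (point_mass M J) = ln (point_mass M J J / prior M J)"
      unfolding KL_def by (rule sum_point_mass[OF assms(2)])
    then show ?thesis
      using assms(2) unfolding Q_crit_def aggJ sum_point_mass[OF assms(2)] enorm_sq f_def
      by (simp add: point_mass_def)
  qed
  have avg: "(\<Sum>K\<in>?S. w K * vinner n x (f K)) = vinner n x est" for x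
    by (simp add: est aggregate_def vinner_lin_comb f_def)
  define F where "F = (\<Sum>K\<in>?S. w K * vinner n (f K) (f K))"
  have sq_avg: "(\<Sum>K\<in>?S. w K * vinner n (vdiff n x (f K)) (vdiff n x (f K)))
      = vinner n x x - 2 * vinner n x est + F" for x
  proof -
    have "(\<Sum>K\<in>?S. w K * vinner n (vdiff n x (f K)) (vdiff n x (f K)))
      = (\<Sum>K\<in>?S. w K * vinner n x x - 2 * (w K * vinner n x (f K)) + w K * vinner n (f K) (f K))"
      by (intro sum.cong) (simp_all add: vinner_vdiff vinner_commute algebra_simps)
    also have "\<dots> = vinner n x x - 2 * vinner n x est + F"
      using w(2) by (simp add: sum.distrib sum_subtractf avg F_def flip: sum_distrib_left sum_distrib_right)
    finally show ?thesis .
  qed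
  have noise_avg: "(\<Sum>K\<in>?S. w K * (2 * vinner n \<xi> (vdiff n (f K) (f J))
       - 1/2 * vinner n (vdiff n (f K) (f J)) (vdiff n (f K) (f J)) + q))
     = 2 * vinner n \<xi> est - 2 * vinner n \<xi> (f J)
       - 1/2 * (vinner n (f J) (f J) - 2 * vinner n (f J) est + F) + q" (is "?N = _")
  proof -
    have "?N = (\<Sum>K\<in>?S. 2 * (w K * vinner n \<xi> (f K)) - w K * (2 * vinner n \<xi> (f J))
       - 1/2 * (w K * vinner n (vdiff n (f J) (f K)) (vdiff n (f J) (f K))) + w K * q)"
      by (intro sum.cong) (simp_all add: vinner_vdiff algebra_simps)
    also have "\<dots> = 2 * (\<Sum>K\<in>?S. w K * vinner n \<xi> (f K)) - (\<Sum>K\<in>?S. w K) * (2 * vinner n \<xi> (f J))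
       - 1/2 * (\<Sum>K\<in>?S. w K * vinner n (vdiff n (f J) (f K)) (vdiff n (f J) (f K))) + (\<Sum>K\<in>?S. w K) * q"
      by (simp only: sum.distrib sum_subtractf sum_distrib_left sum_distrib_right)
    finally show ?thesis by (simp only: avg sq_avg w(2))
  qed
  have "Q_crit n M \<sigma> (1/2) ?L \<mu>s Y w + (1 - 1/2) * (enorm n (vdiff n (aggregate n M \<mu>s Y w)
      (aggregate n M \<mu>s Y (point_mass M J))))\<^sup>2 \<le> Q_crit n M \<sigma> (1/2) ?L \<mu>s Y (point_mass M J)"
    by (rule Q_crit_minimizer_strong[OF point_mass_prob_vectors[OF assms(2)] _ w_def]) simp
  then have opt: "1/2 * (vinner n Y Y - 2 * vinner n Y est + F) + 1/2 * vinner n (vdiff n Y est) (vdiff n Y est)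
      + (\<Sum>K\<in>?S. w K * ?C K) + ?L * KL M w + 1/2 * vinner n (vdiff n est (f J)) (vdiff n est (f J))
    \<le> vinner n (vdiff n Y (f J)) (vdiff n Y (f J)) + ?C J + ?L * ln (1 / prior M J)"
    unfolding QJ aggJ est[symmetric] unfolding Q_crit_def est[symmetric] enorm_sq f_def[symmetric] sq_avg
    by simp
  have risk: "vinner n (vdiff n (f J) \<mu>) (vdiff n (f J) \<mu>) = (enorm n (vdiff n (proj n \<mu>s J \<mu>) \<mu>))\<^sup>2 + q"
    using proj_risk[OF finJ refl, of n \<mu>s \<mu> \<xi>] unfolding q_def f_def Y_def by (simp only: enorm_sq)
  have main: "vinner n (vdiff n est \<mu>) (vdiff n est \<mu>) \<le> (enorm n (vdiff n (proj n \<mu>s J \<mu>) \<mu>))\<^sup>2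
      + ?C J + ?L * ln (1 / prior M J) + (?N - (\<Sum>K\<in>?S. w K * ?C K)) - ?L * KL M w"
    using opt risk unfolding noise_avg
    by (simp add: vinner_vdiff vinner_commute Y_def vinner_vadd algebra_simps)
  have expo: "(3 * vinner n (p K) (p K) - ?C K) / ?L
      = 3 / 20 / \<sigma>\<^sup>2 * vinner n (p K) (p K) - trace_op n (proj n \<mu>s K) / 5" for K
    using assms(1) by (simp add: field_simps)
  have noise: "?N - (\<Sum>K\<in>?S. w K * ?C K) \<le> (\<Sum>K\<in>?S. w K * (3 * vinner n (p K) (p K) - ?C K))"
  proof -
    have "?N \<le> (\<Sum>K\<in>?S. w K * (3 * vinner n (p K) (p K)))"
      using w(1) noise_absorption[OF finJ finK refl refl] unfolding f_def p_def q_def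
      by (intro sum_mono mult_left_mono) auto
    then show ?thesis by (simp add: right_diff_distrib sum_subtractf)
  qed
  have "(\<Sum>K\<in>?S. w K * (3 * vinner n (p K) (p K) - ?C K)) - ?L * KL M w
      \<le> ?L * ln (\<Sum>K\<in>?S. prior M K * exp ((3 * vinner n (p K) (p K) - ?C K) / ?L))"
    unfolding KL_def using assms(1) w prior_pos by (intro gibbs_variational) auto
  then have gibbs: "(\<Sum>K\<in>?S. w K * (3 * vinner n (p K) (p K) - ?C K)) - ?L * KL M w
      \<le> ?L * ln (\<Sum>K\<in>?S. prior M K *
          exp (3 / 20 / \<sigma>\<^sup>2 * vinner n (p K) (p K) - trace_op n (proj n \<mu>s K) / 5))"
    unfolding expo .
  have "vinner n (vdiff n est \<mu>) (vdiff n est \<mu>) \<le> (enorm n (vdiff n (proj n \<mu>s J \<mu>) \<mu>))\<^sup>2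
      + ?C J + ?L * ln (1 / prior M J) + ?L * ln (\<Sum>K\<in>?S. prior M K *
          exp (3 / 20 / \<sigma>\<^sup>2 * vinner n (p K) (p K) - trace_op n (proj n \<mu>s K) / 5))"
    using main noise gibbs by linarith
  moreover have "?C J \<le> 4 * \<sigma>\<^sup>2 * real (card J)"
  proof -
    obtain U where "span_basis n \<mu>s J U" "card U \<le> card J" using span_basis_exists[OF finJ] by blast
    then show ?thesis using assms(1) by (simp add: trace_proj)
  qed
  ultimately show ?thesis unfolding enorm_sq[of "vdiff n est \<mu>" n] by linarith
qed

section \<open>The good event\<close>

lemma projection_moment:
  assumes "0 < \<sigma>" "finite J" "finite K"
    and h_def: "h = (\<lambda>\<xi>. 3 / 20 / \<sigma>\<^sup>2 * vinner n (proj n \<mu>s (K \<union> J) \<xi>) (proj n \<mu>s (K \<union> J) \<xi>)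
      - trace_op n (proj n \<mu>s K) / 5)"
  shows "h \<in> borel_measurable (gaussian n \<sigma>)"
    and "(\<integral>\<^sup>+\<xi>. ennreal (exp (h \<xi>)) \<partial>gaussian n \<sigma>) \<le> ennreal (exp (real (card J) / 5))"
proof -
  obtain U where U: "span_basis n \<mu>s K U"
    using span_basis_exists[OF assms(3)] by blast
  obtain V where V: "span_basis n \<mu>s (K \<union> J) V" "card V \<le> card U + card J"
    using span_basis_Un[OF U assms(3,2)] by blast
  have on: "orthonormal n V" using V(1) by (simp add: span_basis_def)
  have h: "h \<xi> = 3 / 20 / \<sigma>\<^sup>2 * (\<Sum>u\<in>V. (vinner n u \<xi>)\<^sup>2) - real (card U) / 5" for \<xi>
    unfolding h_def proj_sq[OF V(1)] trace_proj[OF U] ..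
  have [measurable]: "(\<lambda>\<xi>. vinner n u \<xi>) \<in> borel_measurable (gaussian n \<sigma>)" for u
    unfolding vinner_def gaussian_def by measurable
  show meas: "h \<in> borel_measurable (gaussian n \<sigma>)"
    unfolding h[abs_def] by measurable
  have "(\<integral>\<^sup>+\<xi>. ennreal (exp (h \<xi>)) \<partial>gaussian n \<sigma>)
     = (\<integral>\<^sup>+\<xi>. ennreal (exp (- (real (card U) / 5))) *
          ennreal (exp (3 / 20 / \<sigma>\<^sup>2 * (\<Sum>u\<in>V. (vinner n u \<xi>)\<^sup>2))) \<partial>gaussian n \<sigma>)"
    by (intro nn_integral_cong) (simp add: h flip: ennreal_mult exp_add)
  also have "\<dots> = ennreal (exp (- (real (card U) / 5))) *
      (\<integral>\<^sup>+\<xi>. ennreal (exp (3 / 20 / \<sigma>\<^sup>2 * (\<Sum>u\<in>V. (vinner n u \<xi>)\<^sup>2))) \<partial>gaussian n \<sigma>)"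
    by (rule nn_integral_cmult) measurable
  also have "\<dots> \<le> ennreal (exp (- (real (card U) / 5))) * ennreal (exp (real (card V) / 5))"
    by (intro mult_left_mono gaussian_exp_projection_bound[OF on assms(1)]) simp
  also have "\<dots> = ennreal (exp ((real (card V) - real (card U)) / 5))"
    by (simp add: diff_divide_distrib flip: ennreal_mult exp_add)
  also have "\<dots> \<le> ennreal (exp (real (card J) / 5))"
    using V(2) by (intro ennreal_leI) simp
  finally show "(\<integral>\<^sup>+\<xi>. ennreal (exp (h \<xi>)) \<partial>gaussian n \<sigma>) \<le> ennreal (exp (real (card J) / 5))" .
qed

text \<open>The partition function of the Gibbs measure that occurs in \<open>estimator_bound\<close>.\<close>

definition noise_partition :: "nat \<Rightarrow> nat \<Rightarrow> real \<Rightarrow> (nat \<Rightarrow> nat \<Rightarrow> real) \<Rightarrow> (nat \<Rightarrow> real) \<Rightarrow> nat set \<Rightarrow> real" where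
  "noise_partition n M \<sigma> \<mu>s \<xi> J = (\<Sum>K\<in>Pow {1..M}. prior M K *
     exp (3 / 20 / \<sigma>\<^sup>2 * vinner n (proj n \<mu>s (K \<union> J) \<xi>) (proj n \<mu>s (K \<union> J) \<xi>)
          - trace_op n (proj n \<mu>s K) / 5))"

text \<open>The single random variable X sums the partition functions of all J with weights
\<open>prior M J * exp (- card J / 5)\<close>.  Its expectation is at most 1, so Markov's inequality for X
replaces a union bound over J, at the price of the factor \<open>1 / prior M J\<close>.\<close>

lemma noise_partition_event:
  assumes "0 < \<sigma>" "0 < \<delta>" "\<delta> < 1"
  shows "\<exists>E\<in>sets (gaussian n \<sigma>). measure (gaussian n \<sigma>) E \<ge> 1 - \<delta> \<and>
    (\<forall>\<xi>\<in>E. \<forall>J. J \<subseteq> {1..M} \<longrightarrow>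
       noise_partition n M \<sigma> \<mu>s \<xi> J \<le> exp (real (card J) / 5) / (prior M J * \<delta>))"
proof -
  let ?S = "Pow {1..M}" and ?G = "gaussian n \<sigma>"
  interpret prob_space ?G using assms(1) by (rule prob_space_gaussian)
  have fin: "finite J" if "J \<in> ?S" for J using that finite_subset by auto
  define h where "h J K \<xi> = 3 / 20 / \<sigma>\<^sup>2 * vinner n (proj n \<mu>s (K \<union> J) \<xi>) (proj n \<mu>s (K \<union> J) \<xi>)
      - trace_op n (proj n \<mu>s K) / 5" for J K \<xi>
  have meas: "h J K \<in> borel_measurable ?G" if "J \<in> ?S" "K \<in> ?S" for J K
    by (rule projection_moment(1)[OF assms(1) fin[OF that(1)] fin[OF that(2)]]) (rule ext, rule h_def)
  have int: "(\<integral>\<^sup>+\<xi>. ennreal (exp (h J K \<xi>)) \<partial>?G) \<le> ennreal (exp (real (card J) / 5))"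
    if "J \<in> ?S" "K \<in> ?S" for J K
    by (rule projection_moment(2)[OF assms(1) fin[OF that(1)] fin[OF that(2)]]) (rule ext, rule h_def)
  define a where "a J K = prior M J * exp (- (real (card J) / 5)) * prior M K" for J K
  have a_nonneg: "0 \<le> a J K" if "J \<in> ?S" "K \<in> ?S" for J K
    using that prior_pos[of J M] prior_pos[of K M] by (simp add: a_def)
  define X where "X \<xi> = (\<Sum>J\<in>?S. \<Sum>K\<in>?S. a J K * exp (h J K \<xi>))" for \<xi>
  have X_alt: "X \<xi> = (\<Sum>J\<in>?S. prior M J * exp (- (real (card J) / 5)) * noise_partition n M \<sigma> \<mu>s \<xi> J)" for \<xi>
    unfolding X_def noise_partition_def h_def a_def by (simp add: sum_distrib_left mult.assoc)
  have [measurable]: "X \<in> borel_measurable ?G"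
    unfolding X_def[abs_def] using meas by (intro borel_measurable_sum borel_measurable_times) auto
  have "(\<integral>\<^sup>+\<xi>. ennreal (X \<xi>) \<partial>?G) = (\<integral>\<^sup>+\<xi>. (\<Sum>J\<in>?S. \<Sum>K\<in>?S. ennreal (a J K) * ennreal (exp (h J K \<xi>))) \<partial>?G)"
  proof (rule nn_integral_cong)
    fix \<xi>
    have nonneg: "0 \<le> a J K * exp (h J K \<xi>)" if "J \<in> ?S" "K \<in> ?S" for J K
      using a_nonneg[OF that] by simp
    have "ennreal (X \<xi>) = (\<Sum>J\<in>?S. ennreal (\<Sum>K\<in>?S. a J K * exp (h J K \<xi>)))"
      unfolding X_def using nonneg by (intro sum_ennreal[symmetric] sum_nonneg)
    also have "\<dots> = (\<Sum>J\<in>?S. \<Sum>K\<in>?S. ennreal (a J K * exp (h J K \<xi>)))"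
      using nonneg by (intro sum.cong refl sum_ennreal[symmetric])
    also have "\<dots> = (\<Sum>J\<in>?S. \<Sum>K\<in>?S. ennreal (a J K) * ennreal (exp (h J K \<xi>)))"
      using a_nonneg by (intro sum.cong refl ennreal_mult) auto
    finally show "ennreal (X \<xi>) = (\<Sum>J\<in>?S. \<Sum>K\<in>?S. ennreal (a J K) * ennreal (exp (h J K \<xi>)))" .
  qed
  also have "\<dots> = (\<Sum>J\<in>?S. \<Sum>K\<in>?S. ennreal (a J K) * (\<integral>\<^sup>+\<xi>. ennreal (exp (h J K \<xi>)) \<partial>?G))"
  proof -
    have m: "(\<lambda>\<xi>. ennreal (exp (h J K \<xi>))) \<in> borel_measurable ?G" if "J \<in> ?S" "K \<in> ?S" for J K
      using meas[OF that] by measurable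
    then have m2: "(\<lambda>\<xi>. ennreal (a J K) * ennreal (exp (h J K \<xi>))) \<in> borel_measurable ?G"
      if "J \<in> ?S" "K \<in> ?S" for J K
      using that by (intro borel_measurable_times_ennreal borel_measurable_const)
    have "(\<integral>\<^sup>+\<xi>. (\<Sum>J\<in>?S. \<Sum>K\<in>?S. ennreal (a J K) * ennreal (exp (h J K \<xi>))) \<partial>?G)
        = (\<Sum>J\<in>?S. \<integral>\<^sup>+\<xi>. (\<Sum>K\<in>?S. ennreal (a J K) * ennreal (exp (h J K \<xi>))) \<partial>?G)"
      using m2 by (intro nn_integral_sum borel_measurable_sum)
    also have "\<dots> = (\<Sum>J\<in>?S. \<Sum>K\<in>?S. \<integral>\<^sup>+\<xi>. ennreal (a J K) * ennreal (exp (h J K \<xi>)) \<partial>?G)"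
      using m2 by (intro sum.cong refl nn_integral_sum)
    also have "\<dots> = (\<Sum>J\<in>?S. \<Sum>K\<in>?S. ennreal (a J K) * (\<integral>\<^sup>+\<xi>. ennreal (exp (h J K \<xi>)) \<partial>?G))"
      using m by (intro sum.cong refl nn_integral_cmult)
    finally show ?thesis .
  qed
  also have "\<dots> \<le> (\<Sum>J\<in>?S. \<Sum>K\<in>?S. ennreal (a J K) * ennreal (exp (real (card J) / 5)))"
    by (intro sum_mono mult_left_mono int) auto
  also have "\<dots> = (\<Sum>J\<in>?S. \<Sum>K\<in>?S. ennreal (prior M J * prior M K))"
  proof (intro sum.cong refl)
    fix J K assume JK: "J \<in> ?S" "K \<in> ?S"
    have "a J K * exp (real (card J) / 5) = prior M J * prior M K"
      by (simp add: a_def exp_minus)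
    then show "ennreal (a J K) * ennreal (exp (real (card J) / 5)) = ennreal (prior M J * prior M K)"
      using a_nonneg[OF JK] by (simp flip: ennreal_mult)
  qed
  also have "\<dots> = ennreal (\<Sum>J\<in>?S. \<Sum>K\<in>?S. prior M J * prior M K)"
  proof -
    have nonneg: "0 \<le> prior M J * prior M K" if "J \<in> ?S" "K \<in> ?S" for J K
      using prior_pos[of J M] prior_pos[of K M] that by simp
    have "(\<Sum>J\<in>?S. \<Sum>K\<in>?S. ennreal (prior M J * prior M K)) = (\<Sum>J\<in>?S. ennreal (\<Sum>K\<in>?S. prior M J * prior M K))"
      using nonneg by (intro sum.cong refl sum_ennreal)
    also have "\<dots> = ennreal (\<Sum>J\<in>?S. \<Sum>K\<in>?S. prior M J * prior M K)"
      using nonneg by (intro sum_ennreal sum_nonneg)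
    finally show ?thesis .
  qed
  also have "(\<Sum>J\<in>?S. \<Sum>K\<in>?S. prior M J * prior M K) = 1"
    by (simp add: prior_sum flip: sum_distrib_left)
  finally have EX: "(\<integral>\<^sup>+\<xi>. ennreal (X \<xi>) \<partial>?G) \<le> 1" by simp
  define N where "N = {\<xi> \<in> space ?G. 1 \<le> ennreal \<delta> * ennreal (X \<xi>)}"
  have N: "N \<in> sets ?G" unfolding N_def by measurable
  have "emeasure ?G N \<le> ennreal \<delta> * (\<integral>\<^sup>+\<xi>. ennreal (X \<xi>) * indicator (space ?G) \<xi> \<partial>?G)"
    unfolding N_def by (rule nn_integral_Markov_inequality) auto
  also have "(\<integral>\<^sup>+\<xi>. ennreal (X \<xi>) * indicator (space ?G) \<xi> \<partial>?G) = (\<integral>\<^sup>+\<xi>. ennreal (X \<xi>) \<partial>?G)"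
    by (intro nn_integral_cong) simp
  also have "ennreal \<delta> * \<dots> \<le> ennreal \<delta> * 1" using EX by (rule mult_left_mono) simp
  finally have "measure ?G N \<le> \<delta>"
    using assms(2) by (simp add: emeasure_eq_measure)
  then have "measure ?G (space ?G - N) \<ge> 1 - \<delta>"
    using prob_compl[OF N] by simp
  moreover have "noise_partition n M \<sigma> \<mu>s \<xi> J \<le> exp (real (card J) / 5) / (prior M J * \<delta>)"
    if \<xi>: "\<xi> \<in> space ?G - N" and J: "J \<subseteq> {1..M}" for \<xi> J
  proof -
    have nonneg: "0 \<le> prior M J * exp (- (real (card J) / 5)) * noise_partition n M \<sigma> \<mu>s \<xi> J"
      if "J \<in> ?S" for J
      using prior_pos[of J M] prior_pos[of _ M] that unfolding noise_partition_def
      by (intro mult_nonneg_nonneg sum_nonneg) (auto intro!: less_imp_le)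
    have "\<not> 1 \<le> \<delta> * X \<xi>"
      using \<xi> assms(2) ennreal_leI[of 1 "\<delta> * X \<xi>"] by (auto simp: N_def ennreal_mult')
    then have "X \<xi> \<le> 1 / \<delta>" using assms(2) by (simp add: field_simps)
    moreover have "prior M J * exp (- (real (card J) / 5)) * noise_partition n M \<sigma> \<mu>s \<xi> J \<le> X \<xi>"
      unfolding X_alt using nonneg J by (intro member_le_sum) auto
    ultimately have "prior M J * exp (- (real (card J) / 5)) * noise_partition n M \<sigma> \<mu>s \<xi> J \<le> 1 / \<delta>"
      by simp
    then show ?thesis
      using prior_pos[OF J] assms(2) by (simp add: exp_minus field_simps)
  qed
  moreover have "space ?G - N \<in> sets ?G" using N by auto
  ultimately show ?thesis by blast
qed

text \<open>There are \<open>M choose k\<close> sets with k elements, so the sum is a geometric sum in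
\<open>exp (- 1) \<le> 1/2\<close>.\<close>

lemma prior_normalization_le: "(\<Sum>J\<in>Pow {1..M}. prior_weight M J) \<le> 2"
proof -
  have "(\<Sum>J\<in>Pow {1..M}. prior_weight M J)
      = (\<Sum>k\<in>{..M}. \<Sum>J\<in>{J \<in> Pow {1..M}. card J = k}. prior_weight M J)"
    using card_mono[of "{1..M}"] by (intro sum.group[symmetric]) auto
  also have "\<dots> = (\<Sum>k\<in>{..M}. exp (- real k))"
  proof (rule sum.cong[OF refl])
    fix k assume "k \<in> {..M}"
    then have "(\<Sum>J\<in>{J. J \<subseteq> {1..M} \<and> card J = k}. prior_weight M J) = exp (- real k)"
      using n_subsets[of "{1..M}" k] by (simp add: prior_weight_def)
    then show "(\<Sum>J\<in>{J \<in> Pow {1..M}. card J = k}. prior_weight M J) = exp (- real k)"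
      by simp
  qed
  also have "\<dots> \<le> (\<Sum>k\<in>{..M}. (1 / 2) ^ k)"
  proof (rule sum_mono)
    fix k
    have "exp (- 1) \<le> (1 / 2 :: real)"
      using exp_ge_add_one_self[of 1] by (simp add: exp_minus field_simps)
    then have "exp (- 1) ^ k \<le> (1 / 2 :: real) ^ k" by (intro power_mono) auto
    then show "exp (- real k) \<le> (1 / 2 :: real) ^ k"
      by (simp flip: exp_of_nat_mult)
  qed
  also have "\<dots> = 2 - (1 / 2) ^ M"
    by (induction M) auto
  finally show ?thesis using zero_le_power[of "1/2::real" M] by linarith
qed

text \<open>One term of the exponential series.\<close>

lemma power_self_le_exp_fact: "real d ^ d \<le> exp (real d) * fact d"
proof -
  have "(\<lambda>k. real d ^ k / fact k) sums exp (real d)"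
    using exp_converges[of "real d"] by (simp add: divide_inverse mult.commute)
  then have "(\<Sum>k\<in>{d}. real d ^ k / fact k) \<le> exp (real d)"
    by (intro sum_le_suminf[THEN order_trans] ) (auto simp: sums_iff)
  then show ?thesis by (simp add: field_simps)
qed

text \<open>This is \<open>(M choose d) \<le> (e * M / d)^d\<close>, up to the normalization of the prior.\<close>

lemma ln_inverse_prior_le:
  assumes "J \<subseteq> {1..M}" "card J = d" "1 \<le> d"
  shows "ln (1 / prior M J) \<le> 2 * real d + real d * ln (real M / real d) + 1"
proof -
  define Z where "Z = (\<Sum>J\<in>Pow {1..M}. prior_weight M J)"
  have Z: "0 < Z" unfolding Z_def by (intro sum_pos) (auto intro: prior_weight_pos)
  have "Z \<le> 2" unfolding Z_def by (rule prior_normalization_le)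
  then have "ln Z \<le> 1" using Z ln_le_minus_one[of Z] by linarith
  have dM: "d \<le> M" using card_mono[OF _ assms(1)] assms(2) by simp
  have C: "0 < real (M choose d)" using dM by simp
  have "real (M choose d) * fact d \<le> real M ^ d"
    using binomial_fact_pow[of M d] by (metis of_nat_fact of_nat_le_iff of_nat_mult of_nat_power)
  then have "ln (real (M choose d) * fact d) \<le> ln (real M ^ d)"
    using C by (subst ln_le_cancel_iff) (auto intro: less_le_trans[OF _ \<open>_ \<le> real M ^ d\<close>])
  then have "ln (real (M choose d)) + ln (fact d) \<le> d * ln M"
    using C dM assms(3) by (simp add: ln_mult ln_realpow)
  moreover have "d * ln d \<le> d + ln (fact d :: real)"
  proof -
    have "ln (real d ^ d) \<le> ln (exp (real d) * fact d)"
      using power_self_le_exp_fact[of d] assms(3) by (subst ln_le_cancel_iff) auto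
    then show ?thesis using assms(3) by (simp add: ln_mult ln_realpow)
  qed
  moreover have "real d * ln (real M / real d) = d * ln M - d * ln d"
    using dM assms(3) by (simp add: ln_div right_diff_distrib)
  ultimately have "ln (real (M choose d)) \<le> d + d * ln (M / d)"
    by linarith
  moreover have "1 / prior M J = Z * (real (M choose d) * exp (real d))"
  proof -
    have "prior M J = exp (- real d) / real (M choose d) / Z"
      by (simp add: prior_def prior_weight_def[of M J] assms(2) Z_def)
    then show ?thesis by (simp add: exp_minus field_simps)
  qed
  moreover have "ln (Z * (real (M choose d) * exp (real d))) = ln Z + ln (real (M choose d)) + d"
    using Z C by (simp add: ln_mult)
  ultimately show ?thesis using \<open>ln Z \<le> 1\<close> by simp
qed

text \<open>The bound \<open>\<delta> < 1/2\<close> keeps \<open>ln (1 / \<delta>)\<close> above 1/2, so that all additive constants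
can be absorbed into \<open>d * ln (1 / \<delta>)\<close>; the constant 276 is 256 + 20.\<close>

lemma sparse_oracle_inequality:
  assumes "0 < \<sigma>" "0 < \<delta>" "\<delta> < 1 / 2" "J \<subseteq> {1..M}" "card J = d" "1 \<le> d" "v \<in> fspan n \<mu>s J"
    and noise: "noise_partition n M \<sigma> \<mu>s \<xi> J \<le> exp (real (card J) / 5) / (prior M J * \<delta>)"
    and est_def: "est = Q_estimator n M \<sigma> (1/2) (20 * \<sigma>\<^sup>2) \<mu>s (vadd n \<mu> \<xi>)"
  shows "(enorm n (vdiff n est \<mu>))\<^sup>2
    \<le> (enorm n (vdiff n v \<mu>))\<^sup>2 + 276 * (\<sigma>\<^sup>2 * real d * ln (real M / (\<delta> * real d)))"
proof -
  have finJ: "finite J" using assms(4) finite_subset by blast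
  have dM: "d \<le> M" using card_mono[OF _ assms(4)] assms(5) by simp
  let ?P = "noise_partition n M \<sigma> \<mu>s \<xi> J" and ?l = "ln (1 / prior M J)"
  have pr: "0 < prior M J" by (rule prior_pos[OF assms(4)])
  have P: "0 < ?P"
    unfolding noise_partition_def using prior_pos by (intro sum_pos) auto
  have "ln ?P \<le> ln (exp (real d / 5) / (prior M J * \<delta>))"
    using noise P assms(5) by simp
  also have "\<dots> = real d / 5 + ?l + ln (1 / \<delta>)"
    using pr assms(2) by (simp add: ln_div ln_mult)
  finally have lnP: "ln ?P \<le> real d / 5 + ?l + ln (1 / \<delta>)" .
  have l: "?l \<le> 2 * real d + real d * ln (real M / real d) + 1"
    by (rule ln_inverse_prior_le[OF assms(4-6)])
  have ln\<delta>: "1 / 2 \<le> ln (1 / \<delta>)"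
  proof -
    have "1 / 2 \<le> ln (2 :: real)" using ln_le_minus_one[of "1 / 2 :: real"] by (simp add: ln_div)
    also have "\<dots> \<le> ln (1 / \<delta>)" using assms(2,3) by (simp add: field_simps)
    finally show ?thesis .
  qed
  have lnMd: "0 \<le> ln (real M / real d)" using dM assms(6) by simp
  have split: "ln (real M / (\<delta> * real d)) = ln (real M / real d) + ln (1 / \<delta>)"
    using dM assms(2,6) by (simp add: ln_div ln_mult)
  have "4 * real d + 20 * ?l + 20 * ln ?P \<le> 276 * (real d * ln (real M / (\<delta> * real d)))"
  proof -
    have "4 * real d + 20 * ?l + 20 * ln ?P
        \<le> 88 * real d + 40 * (real d * ln (real M / real d)) + 40 + 20 * ln (1 / \<delta>)"
      using lnP l by simp
    also have "\<dots> \<le> 276 * (real d * ln (real M / real d)) + 276 * (real d * ln (1 / \<delta>))"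
    proof -
      have "real d * (1/2) \<le> real d * ln (1 / \<delta>)" using ln\<delta> by (intro mult_left_mono) auto
      moreover have "1 * ln (1 / \<delta>) \<le> real d * ln (1 / \<delta>)" using ln\<delta> assms(6) by (intro mult_right_mono) auto
      moreover have "0 \<le> real d * ln (real M / real d)" using lnMd by simp
      moreover have "1 \<le> real d" using assms(6) by simp
      ultimately show ?thesis by linarith
    qed
    also have "\<dots> = 276 * (real d * ln (real M / (\<delta> * real d)))" by (simp add: split algebra_simps)
    finally show ?thesis .
  qed
  then have "\<sigma>\<^sup>2 * (4 * real d + 20 * ?l + 20 * ln ?P) \<le> \<sigma>\<^sup>2 * (276 * (real d * ln (real M / (\<delta> * real d))))"
    by (intro mult_left_mono) auto
  moreover have "(enorm n (vdiff n est \<mu>))\<^sup>2 \<le> (enorm n (vdiff n (proj n \<mu>s J \<mu>) \<mu>))\<^sup>2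
     + 4 * \<sigma>\<^sup>2 * real (card J) + 20 * \<sigma>\<^sup>2 * ?l + 20 * \<sigma>\<^sup>2 * ln ?P"
    unfolding noise_partition_def by (rule estimator_bound[OF assms(1,4) est_def refl])
  moreover have "(enorm n (vdiff n (proj n \<mu>s J \<mu>) \<mu>))\<^sup>2 \<le> (enorm n (vdiff n v \<mu>))\<^sup>2"
    by (rule proj_best[OF finJ assms(7)])
  moreover have "\<sigma>\<^sup>2 * (4 * real d + 20 * ?l + 20 * ln ?P)
      = 4 * \<sigma>\<^sup>2 * real (card J) + 20 * \<sigma>\<^sup>2 * ?l + 20 * \<sigma>\<^sup>2 * ln ?P"
    by (simp add: assms(5) distrib_left)
  moreover have "\<sigma>\<^sup>2 * (276 * (real d * ln (real M / (\<delta> * real d)))) = 276 * (\<sigma>\<^sup>2 * real d * ln (real M / (\<delta> * real d)))"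
    by simp
  ultimately show ?thesis by linarith
qed

section \<open>Sparse approximation in lq balls\<close>

lemma exists_le_weighted_mean:
  fixes p f :: "'a \<Rightarrow> real"
  assumes "finite I" "\<And>j. j \<in> I \<Longrightarrow> 0 \<le> p j" "(\<Sum>j\<in>I. p j) = 1" "(\<Sum>j\<in>I. p j * f j) \<le> c"
  shows "\<exists>j\<in>I. f j \<le> c"
proof (rule ccontr)
  assume "\<not> (\<exists>j\<in>I. f j \<le> c)"
  then have f: "\<And>j. j \<in> I \<Longrightarrow> c < f j" by auto
  have "\<exists>j\<in>I. p j \<noteq> 0" using assms(3) by (metis sum.neutral zero_neq_one)
  then obtain j where j: "j \<in> I" "0 < p j" using assms(2) by force
  have "(\<Sum>j\<in>I. p j * c) < (\<Sum>j\<in>I. p j * f j)"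
  proof (rule sum_strict_mono_ex1[OF assms(1)])
    show "\<forall>j\<in>I. p j * c \<le> p j * f j"
      using assms(2) f by (intro ballI mult_left_mono) (auto simp: less_imp_le)
    show "\<exists>j\<in>I. p j * c < p j * f j" using j f by (intro bexI[of _ j]) auto
  qed
  then show False using assms(3,4) by (simp flip: sum_distrib_right)
qed

lemma vinner_affine:
  "vinner n (\<lambda>i. a i + s * (x i - g i)) (\<lambda>i. a i + s * (x i - g i)) =
     vinner n a a + 2 * s * (vinner n a x - vinner n a g)
       + s\<^sup>2 * (vinner n x x - 2 * vinner n x g + vinner n g g)"
  unfolding vinner_def sum_distrib_left sum.distrib[symmetric] sum_subtractf[symmetric]
  by (intro sum.cong) (simp_all add: power2_eq_square algebra_simps)

lemma vinner_sum_right: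
  assumes "\<And>i. i \<in> {1..n} \<Longrightarrow> g i = (\<Sum>j\<in>I. p j * X j i)"
  shows "vinner n x g = (\<Sum>j\<in>I. p j * vinner n x (X j))"
proof -
  have "vinner n x g = vinner n x (lin_comb n I p X)"
    by (rule vinner_cong) (simp_all add: assms lin_comb_apply)
  then show ?thesis by (simp add: vinner_lin_comb)
qed

text \<open>If an index is drawn with probabilities p, then \<open>X j - g\<close> has mean zero, so the expectation of the
squared norm is \<open>|a|^2\<close> plus \<open>s^2\<close> times a variance.  Some index is at least as good as the
mean.\<close>

lemma sampling_step:
  fixes p :: "'a \<Rightarrow> real"
  assumes "finite I" "\<And>j. j \<in> I \<Longrightarrow> 0 \<le> p j" "(\<Sum>j\<in>I. p j) = 1"
    "\<And>i. i \<in> {1..n} \<Longrightarrow> g i = (\<Sum>j\<in>I. p j * X j i)"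
    "\<And>j. j \<in> I \<Longrightarrow> vinner n (X j) (X j) \<le> \<beta>"
  shows "\<exists>j\<in>I. vinner n (\<lambda>i. a i + s * (X j i - g i)) (\<lambda>i. a i + s * (X j i - g i))
     \<le> vinner n a a + s\<^sup>2 * \<beta>"
proof (rule exists_le_weighted_mean[OF assms(1,2,3)])
  have g: "vinner n y g = (\<Sum>j\<in>I. p j * vinner n y (X j))" for y
    by (rule vinner_sum_right) (rule assms(4))
  let ?v = "\<Sum>j\<in>I. p j * vinner n (X j) (X j)"
  have "(\<Sum>j\<in>I. p j * vinner n (\<lambda>i. a i + s * (X j i - g i)) (\<lambda>i. a i + s * (X j i - g i)))
      = (\<Sum>j\<in>I. p j * (vinner n a a - 2 * s * vinner n a g + s\<^sup>2 * vinner n g g)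
          + 2 * s * (p j * vinner n a (X j)) + s\<^sup>2 * (p j * vinner n (X j) (X j))
          - 2 * s\<^sup>2 * (p j * vinner n g (X j)))"
    unfolding vinner_affine
    by (intro sum.cong) (simp_all add: algebra_simps vinner_commute)
  also have "\<dots> = (\<Sum>j\<in>I. p j) * (vinner n a a - 2 * s * vinner n a g + s\<^sup>2 * vinner n g g)
          + 2 * s * (\<Sum>j\<in>I. p j * vinner n a (X j)) + s\<^sup>2 * ?v
          - 2 * s\<^sup>2 * (\<Sum>j\<in>I. p j * vinner n g (X j))"
    by (simp only: sum.distrib sum_subtractf sum_distrib_left sum_distrib_right)
  also have "\<dots> = vinner n a a + s\<^sup>2 * (?v - vinner n g g)"
    unfolding assms(3) g[symmetric] by (simp add: algebra_simps)
  also have "\<dots> \<le> vinner n a a + s\<^sup>2 * \<beta>"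
  proof -
    have "?v \<le> (\<Sum>j\<in>I. p j * \<beta>)" using assms(2,5) by (intro sum_mono mult_left_mono)
    also have "\<dots> = \<beta>" by (simp add: assms(3) flip: sum_distrib_right)
    finally have "?v - vinner n g g \<le> \<beta>" using vinner_nonneg[of n g] by linarith
    then show ?thesis by (intro add_left_mono mult_left_mono) auto
  qed
  finally show "(\<Sum>j\<in>I. p j * vinner n (\<lambda>i. a i + s * (X j i - g i)) (\<lambda>i. a i + s * (X j i - g i)))
      \<le> vinner n a a + s\<^sup>2 * \<beta>" .
qed

text \<open>Maurey's argument, with one derandomized draw at a time: after m steps, m of the k summands
\<open>g / k\<close> of the target have been replaced by signed generators, and each replacement increases the
squared distance by at most \<open>(r * b / k)^2\<close>.  The offset a plays the role of everything that stays
fixed, so that no constant appears in front of the distance of the target.\<close>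

lemma maurey:
  fixes \<theta> :: "'a \<Rightarrow> real"
  assumes "finite I" "\<And>j. j \<in> I \<Longrightarrow> vinner n (x j) (x j) \<le> b\<^sup>2" "1 \<le> k"
  shows "\<exists>c S. S \<subseteq> I \<and> card S \<le> k \<and> (\<forall>j. j \<notin> S \<longrightarrow> c j = 0) \<and>
    vinner n (\<lambda>i. a i + (\<Sum>j\<in>I. c j * x j i)) (\<lambda>i. a i + (\<Sum>j\<in>I. c j * x j i))
    \<le> vinner n (\<lambda>i. a i + (\<Sum>j\<in>I. \<theta> j * x j i)) (\<lambda>i. a i + (\<Sum>j\<in>I. \<theta> j * x j i))
      + (\<Sum>j\<in>I. \<bar>\<theta> j\<bar>)\<^sup>2 * b\<^sup>2 / real k"
proof (cases "(\<Sum>j\<in>I. \<bar>\<theta> j\<bar>) = 0")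
  case True
  then have "\<And>j. j \<in> I \<Longrightarrow> \<theta> j = 0" using assms(1) by (simp add: sum_nonneg_eq_0_iff)
  then show ?thesis by (intro exI[of _ "\<lambda>_. 0"] exI[of _ "{}"]) simp
next
  case False
  define r where "r = (\<Sum>j\<in>I. \<bar>\<theta> j\<bar>)"
  have "0 \<le> r" unfolding r_def by (intro sum_nonneg) simp
  then have r: "0 < r" using False unfolding r_def by linarith
  define g where "g i = (\<Sum>j\<in>I. \<theta> j * x j i)" for i
  define X where "X j i = sgn (\<theta> j) * r * x j i" for j i
  define A where "A c m i = a i + (\<Sum>j\<in>I. c j * x j i) + (real k - real m) / real k * g i" for c m i
  let ?sq = "\<lambda>v. vinner n v v"
  have p: "(\<Sum>j\<in>I. \<bar>\<theta> j\<bar> / r) = 1" using r by (simp add: r_def flip: sum_divide_distrib)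
  have gX: "g i = (\<Sum>j\<in>I. \<bar>\<theta> j\<bar> / r * X j i)" for i
    unfolding g_def X_def using r by (intro sum.cong) (simp_all add: abs_mult_sgn mult.assoc[symmetric])
  have X: "?sq (X j) \<le> r\<^sup>2 * b\<^sup>2" if "j \<in> I" for j
  proof -
    have "?sq (X j) = (sgn (\<theta> j))\<^sup>2 * (r\<^sup>2 * ?sq (x j))"
      unfolding X_def vinner_def sum_distrib_left by (intro sum.cong) (simp_all add: power2_eq_square)
    also have "\<dots> \<le> 1 * (r\<^sup>2 * b\<^sup>2)"
      using assms(2)[OF that] vinner_nonneg[of n "x j"]
      by (intro mult_mono mult_left_mono) (auto simp: sgn_if)
    finally show ?thesis by simp
  qed
  have "\<exists>c S. S \<subseteq> I \<and> card S \<le> m \<and> (\<forall>j. j \<notin> S \<longrightarrow> c j = 0) \<and>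
      ?sq (A c m) \<le> ?sq (\<lambda>i. a i + g i) + real m * (r\<^sup>2 * b\<^sup>2 / (real k)\<^sup>2)" for m
  proof (induction m)
    case 0
    have "A (\<lambda>_. 0) 0 = (\<lambda>i. a i + g i)" using assms(3) by (simp add: A_def fun_eq_iff)
    then show ?case by (intro exI[of _ "\<lambda>_. 0"] exI[of _ "{}"]) simp
  next
    case (Suc m)
    then obtain c S where cS: "S \<subseteq> I" "card S \<le> m" "\<And>j. j \<notin> S \<Longrightarrow> c j = 0"
      "?sq (A c m) \<le> ?sq (\<lambda>i. a i + g i) + real m * (r\<^sup>2 * b\<^sup>2 / (real k)\<^sup>2)" by blast
    obtain l where l: "l \<in> I"
      "?sq (\<lambda>i. A c m i + 1 / real k * (X l i - g i)) \<le> ?sq (A c m) + (1 / real k)\<^sup>2 * (r\<^sup>2 * b\<^sup>2)"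
      using sampling_step[OF assms(1) _ p gX X, of "A c m" "1 / real k"] r by auto
    define c' where "c' = c(l := c l + sgn (\<theta> l) * r / real k)"
    have "A c' (Suc m) = (\<lambda>i. A c m i + 1 / real k * (X l i - g i))"
    proof
      fix i
      have "(\<Sum>j\<in>I. c' j * x j i) = (\<Sum>j\<in>I. c j * x j i + (if l = j then sgn (\<theta> l) * r / real k * x l i else 0))"
        by (intro sum.cong) (auto simp: c'_def algebra_simps)
      also have "\<dots> = (\<Sum>j\<in>I. c j * x j i) + 1 / real k * X l i"
        using assms(1) l(1) by (simp add: sum.distrib X_def)
      finally show "A c' (Suc m) i = A c m i + 1 / real k * (X l i - g i)"
        using assms(3) by (simp add: A_def field_simps)
    qed
    then have "?sq (A c' (Suc m)) \<le> ?sq (A c m) + (1 / real k)\<^sup>2 * (r\<^sup>2 * b\<^sup>2)"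
      using l(2) by simp
    moreover have "(1 / real k)\<^sup>2 * (r\<^sup>2 * b\<^sup>2) = r\<^sup>2 * b\<^sup>2 / (real k)\<^sup>2"
      by (simp add: power_divide)
    moreover have "real (Suc m) * z = real m * z + z" for z
      by (simp add: algebra_simps)
    ultimately have "?sq (A c' (Suc m)) \<le> ?sq (\<lambda>i. a i + g i) + real (Suc m) * (r\<^sup>2 * b\<^sup>2 / (real k)\<^sup>2)"
      using cS(4) by (simp only: add.assoc)
    moreover have "card (insert l S) \<le> Suc m"
      using cS(2) card_insert_le_m1[of "Suc m" S l] by simp
    moreover have "\<forall>j. j \<notin> insert l S \<longrightarrow> c' j = 0" using cS(3) by (simp add: c'_def)
    moreover have "insert l S \<subseteq> I" using cS(1) l(1) by simp
    ultimately show ?case by blast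
  qed
  from this[of k] obtain c S where cS: "S \<subseteq> I" "card S \<le> k" "\<forall>j. j \<notin> S \<longrightarrow> c j = 0"
      "?sq (A c k) \<le> ?sq (\<lambda>i. a i + g i) + real k * (r\<^sup>2 * b\<^sup>2 / (real k)\<^sup>2)" by blast
  have "A c k = (\<lambda>i. a i + (\<Sum>j\<in>I. c j * x j i))" by (simp add: A_def fun_eq_iff)
  moreover have "real k * (r\<^sup>2 * b\<^sup>2 / (real k)\<^sup>2) = r\<^sup>2 * b\<^sup>2 / real k"
    using assms(3) by (simp add: power2_eq_square)
  ultimately show ?thesis using cS unfolding g_def r_def[symmetric] by (intro exI[of _ c] exI[of _ S]) simp
qed

text \<open>Thresholding at \<open>t = R * k^(- 1 / q)\<close>.  At most k coefficients exceed t, and the others satisfy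
\<open>|\<theta> j| \<le> |\<theta> j|^q * t^(1 - q)\<close>.  This bound on the tail has no constant that degenerates
as q tends to 1.\<close>

lemma qball_threshold:
  assumes "\<theta> \<in> qball M q R" "0 < q" "q \<le> 1" "0 < R" "1 \<le> k"
  shows "\<exists>J\<subseteq>{1..M}. card J \<le> k \<and> (\<Sum>j\<in>{1..M} - J. \<bar>\<theta> j\<bar>) \<le> R * real k powr (1 - 1 / q)"
proof -
  define N where "N = (\<Sum>j\<in>{1..M}. \<bar>\<theta> j\<bar> powr q)"
  have N0: "0 \<le> N" unfolding N_def by (intro sum_nonneg) auto
  have "N powr (1 / q) \<le> R" using assms(1,2) by (simp add: qball_def qnorm_def N_def)
  then have "(N powr (1 / q)) powr q \<le> R powr q" using assms(2) by (intro powr_mono2) auto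
  then have N: "N \<le> R powr q" using assms(2) N0 by (simp add: powr_powr)
  have k: "0 < real k" using assms(5) by simp
  define t where "t = R * real k powr (- 1 / q)"
  have t: "0 < t" using assms(4) k by (simp add: t_def)
  have tq: "t powr q = R powr q / real k"
  proof -
    have "(real k powr (- 1 / q)) powr q = real k powr - 1"
      unfolding powr_powr using assms(2) by simp
    then show ?thesis using assms(4) k by (simp add: t_def powr_mult powr_minus divide_inverse)
  qed
  define J where "J = {j \<in> {1..M}. t < \<bar>\<theta> j\<bar>}"
  have "real (card J) * t powr q = (\<Sum>j\<in>J. t powr q)" by simp
  also have "\<dots> \<le> (\<Sum>j\<in>J. \<bar>\<theta> j\<bar> powr q)"
    using t assms(2) by (intro sum_mono powr_mono2) (auto simp: J_def)
  also have "\<dots> \<le> N" unfolding N_def by (intro sum_mono2) (auto simp: J_def)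
  also have "\<dots> \<le> real k * t powr q" using N k by (simp add: tq)
  finally have "card J \<le> k" using t by (simp add: mult_le_cancel_right)
  moreover have "(\<Sum>j\<in>{1..M} - J. \<bar>\<theta> j\<bar>) \<le> R * real k powr (1 - 1 / q)"
  proof -
    have "(\<Sum>j\<in>{1..M} - J. \<bar>\<theta> j\<bar>) \<le> (\<Sum>j\<in>{1..M} - J. \<bar>\<theta> j\<bar> powr q * t powr (1 - q))"
    proof (rule sum_mono)
      fix j assume "j \<in> {1..M} - J"
      then have j: "\<bar>\<theta> j\<bar> \<le> t" by (auto simp: J_def)
      have "\<bar>\<theta> j\<bar> = \<bar>\<theta> j\<bar> powr q * \<bar>\<theta> j\<bar> powr (1 - q)"
        by (simp flip: powr_add)
      also have "\<dots> \<le> \<bar>\<theta> j\<bar> powr q * t powr (1 - q)"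
        using j assms(3) by (intro mult_left_mono powr_mono2) auto
      finally show "\<bar>\<theta> j\<bar> \<le> \<bar>\<theta> j\<bar> powr q * t powr (1 - q)" .
    qed
    also have "\<dots> \<le> N * t powr (1 - q)"
      unfolding N_def sum_distrib_right by (intro sum_mono2) auto
    also have "\<dots> \<le> R powr q * t powr (1 - q)"
      using N by (intro mult_right_mono) auto
    also have "\<dots> = R * real k powr (1 - 1 / q)"
    proof -
      have "- 1 / q * (1 - q) = 1 - 1 / q" using assms(2) by (simp add: field_simps)
      then have "t powr (1 - q) = R powr (1 - q) * real k powr (1 - 1 / q)"
        using assms(4) k by (simp add: t_def powr_mult powr_powr)
      then show ?thesis using assms(4) by (simp add: mult.assoc[symmetric] flip: powr_add)
    qed
    finally show ?thesis .
  qed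
  ultimately show ?thesis by (intro exI[of _ J]) (auto simp: J_def)
qed

text \<open>Keep the coefficients above the threshold exactly and apply Maurey's argument to the others.\<close>

lemma qball_sparse_approximation:
  assumes "\<theta> \<in> qball M q R" "0 < q" "q \<le> 1" "0 < R" "1 \<le> k" "0 < B"
    and \<mu>s: "\<And>j. j \<in> {1..M} \<Longrightarrow> (enorm n (\<mu>s j))\<^sup>2 \<le> B\<^sup>2"
  shows "\<exists>J\<subseteq>{1..M}. card J \<le> 2 * k \<and> (\<exists>v\<in>fspan n \<mu>s J.
    (enorm n (vdiff n v \<mu>))\<^sup>2 \<le> (enorm n (vdiff n (lin_comb n {1..M} \<theta> \<mu>s) \<mu>))\<^sup>2
      + (B * R)\<^sup>2 * real k powr (1 - 2 / q))"
proof -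
  obtain J where J: "J \<subseteq> {1..M}" "card J \<le> k"
    "(\<Sum>j\<in>{1..M} - J. \<bar>\<theta> j\<bar>) \<le> R * real k powr (1 - 1 / q)"
    using qball_threshold[OF assms(1-5)] by blast
  let ?I = "{1..M} - J"
  let ?sq = "\<lambda>v. vinner n v v"
  have k: "0 < real k" using assms(5) by simp
  define a where "a i = (\<Sum>j\<in>J. \<theta> j * \<mu>s j i) - \<mu> i" for i
  obtain c S where cS: "S \<subseteq> ?I" "card S \<le> k" "\<forall>j. j \<notin> S \<longrightarrow> c j = 0"
    "?sq (\<lambda>i. a i + (\<Sum>j\<in>?I. c j * \<mu>s j i)) \<le> ?sq (\<lambda>i. a i + (\<Sum>j\<in>?I. \<theta> j * \<mu>s j i))
      + (\<Sum>j\<in>?I. \<bar>\<theta> j\<bar>)\<^sup>2 * B\<^sup>2 / real k"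
    using maurey[of ?I n \<mu>s B k a \<theta>] \<mu>s assms(5) unfolding enorm_sq by blast
  define d where "d j = (if j \<in> J then \<theta> j else c j)" for j
  have finJ: "finite J" "finite S" using J(1) cS(1) by (auto intro: finite_subset)
  have full: "(\<Sum>j\<in>{1..M}. e j) = (\<Sum>j\<in>J. e j) + (\<Sum>j\<in>?I. e j)" for e :: "nat \<Rightarrow> real"
    using sum.subset_diff[OF J(1), of e] by (simp add: add.commute)
  have "(\<Sum>j\<in>J \<union> S. d j * \<mu>s j i) = (\<Sum>j\<in>{1..M}. d j * \<mu>s j i)" for i
    using J(1) cS(1,3) by (intro sum.mono_neutral_left) (auto simp: d_def)
  then have d: "(\<Sum>j\<in>J \<union> S. d j * \<mu>s j i) = (\<Sum>j\<in>J. \<theta> j * \<mu>s j i) + (\<Sum>j\<in>?I. c j * \<mu>s j i)" for i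
    unfolding full by (simp add: d_def)
  have "(enorm n (vdiff n (lin_comb n (J \<union> S) d \<mu>s) \<mu>))\<^sup>2 = ?sq (\<lambda>i. a i + (\<Sum>j\<in>?I. c j * \<mu>s j i))"
    unfolding enorm_sq by (intro vinner_cong) (simp_all add: vdiff_def lin_comb_apply d a_def)
  also note cS(4)
  also have "?sq (\<lambda>i. a i + (\<Sum>j\<in>?I. \<theta> j * \<mu>s j i)) = (enorm n (vdiff n (lin_comb n {1..M} \<theta> \<mu>s) \<mu>))\<^sup>2"
    unfolding enorm_sq by (intro vinner_cong) (simp_all add: vdiff_def lin_comb_apply full a_def)
  also have "(\<Sum>j\<in>?I. \<bar>\<theta> j\<bar>)\<^sup>2 * B\<^sup>2 / real k \<le> (R * real k powr (1 - 1 / q))\<^sup>2 * B\<^sup>2 / real k"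
    using J(3) by (intro divide_right_mono mult_right_mono power_mono sum_nonneg) auto
  also have "\<dots> = (B * R)\<^sup>2 * ((real k powr (1 - 1 / q))\<^sup>2 / real k)"
    by (simp add: power_mult_distrib)
  also have "(real k powr (1 - 1 / q))\<^sup>2 / real k = real k powr (1 - 2 / q)"
  proof -
    have "(real k powr (1 - 1 / q))\<^sup>2 / real k = real k powr ((1 - 1 / q) + (1 - 1 / q) - 1)"
      using k by (simp only: powr_add powr_diff power2_eq_square) simp
    also have "(1 - 1 / q) + (1 - 1 / q) - 1 = 1 - 2 / q" by (simp add: field_simps)
    finally show ?thesis .
  qed
  finally have "(enorm n (vdiff n (lin_comb n (J \<union> S) d \<mu>s) \<mu>))\<^sup>2
     \<le> (enorm n (vdiff n (lin_comb n {1..M} \<theta> \<mu>s) \<mu>))\<^sup>2 + (B * R)\<^sup>2 * real k powr (1 - 2 / q)"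
    by simp
  moreover have "card (J \<union> S) \<le> 2 * k" using card_Un_le[of J S] J(2) cS(2) by linarith
  ultimately show ?thesis
    using J(1) cS(1) by (intro exI[of _ "J \<union> S"] conjI bexI[of _ "lin_comb n (J \<union> S) d \<mu>s"])
      (auto simp: lin_comb_in_fspan)
qed

section \<open>Rates for the classes\<close>

text \<open>The number x is the real solution of the balance between the approximation error
\<open>(B * R)^2 * x^(1 - 2 / q)\<close> and the dimension term \<open>\<sigma>^2 * L * x\<close>; both equal the first
entry of the maximum in the rate.  The last conclusion says that \<open>ln (M / (\<delta> * x))\<close>, the
logarithm that actually occurs at dimension x, is comparable with the logarithm L that defines x.\<close>

lemma lq_term_level:
  assumes "0 < \<sigma>" "0 < \<delta>" "0 < B" "0 < R" "0 < q" "q \<le> 1" "1 \<le> M"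
  obtains x L where "0 < x" "1 \<le> L"
    "\<sigma>\<^sup>2 * L * x \<le> lq_term M \<sigma> B q R \<delta>"
    "(B * R)\<^sup>2 = \<sigma>\<^sup>2 * L * x powr (2 / q)"
    "ln (real M / (\<delta> * x)) \<le> 2 * L"
proof -
  define L where "L = logbar (real M / \<delta> * (\<sigma> / (B * R)) powr q)"
  define x where "x = (B * R / (\<sigma> * sqrt L)) powr q"
  have L: "1 \<le> L" by (simp add: L_def logbar_def)
  have M: "0 < real M" using assms(7) by simp
  have x: "0 < x" using assms L by (simp add: x_def)
  have lnx: "ln x = q * (ln B + ln R - ln \<sigma> - ln L / 2)"
    using assms L by (simp add: x_def ln_powr ln_div ln_mult ln_sqrt)
  have "\<sigma>\<^sup>2 * L * x = exp (2 * ln \<sigma> + ln L + ln x)"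
    using assms(1) L x by (simp add: exp_add exp_double)
  also have "\<dots> = exp ((2 - q) * ln \<sigma> + q * ln R + q * ln B + (1 - q / 2) * ln L)"
    unfolding lnx by (simp add: algebra_simps)
  also have "\<dots> = \<sigma> powr (2 - q) * R powr q * B powr q * L powr (1 - q / 2)"
    using assms L by (simp add: powr_def exp_add)
  also have "\<dots> \<le> lq_term M \<sigma> B q R \<delta>"
    by (simp add: lq_term_def L_def)
  finally have 1: "\<sigma>\<^sup>2 * L * x \<le> lq_term M \<sigma> B q R \<delta>" .
  have "x powr (2 / q) = (B * R / (\<sigma> * sqrt L)) powr 2"
    using assms(5) by (simp add: x_def powr_powr)
  also have "\<dots> = (B * R)\<^sup>2 / (\<sigma>\<^sup>2 * L)"
    using assms L by (simp add: power_divide power_mult_distrib)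
  finally have 2: "(B * R)\<^sup>2 = \<sigma>\<^sup>2 * L * x powr (2 / q)"
    using assms(1) L by simp
  have "ln (real M / (\<delta> * x)) = ln (real M / \<delta> * (\<sigma> / (B * R)) powr q) + q / 2 * ln L"
    using assms M x by (simp add: ln_div ln_mult ln_powr lnx algebra_simps)
  also have "\<dots> \<le> L + 1 * L"
  proof (intro add_mono mult_mono)
    show "ln (real M / \<delta> * (\<sigma> / (B * R)) powr q) \<le> L" by (simp add: L_def logbar_def)
    show "ln L \<le> L" using ln_le_minus_one[of L] L by simp
  qed (use assms L in auto)
  finally have 3: "ln (real M / (\<delta> * x)) \<le> 2 * L" by simp
  show thesis using that[OF x L 1 2 3] .
qed

text \<open>The number k is the balanced value x rounded up, and the dimension is 2 k.  If x is at most 1, then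
k = 1; the approximation error is bounded by the first entry of the maximum and the dimension term
by the second.  If 2 k exceeds M, the full set is used: there is no approximation error, and its
dimension term is bounded by the first entry of the maximum because M is then at most 4 x.\<close>

lemma qball_oracle_inequality:
  assumes "0 < \<sigma>" "0 < \<delta>" "\<delta> < 1 / 2" "3 \<le> M" "0 < B" "0 < q" "q \<le> 1" "0 < R"
    and \<mu>s: "\<And>j. j \<in> {1..M} \<Longrightarrow> (enorm n (\<mu>s j))\<^sup>2 \<le> B\<^sup>2"
    and support_bound: "\<And>J d v. J \<subseteq> {1..M} \<Longrightarrow> card J = d \<Longrightarrow> 1 \<le> d \<Longrightarrow> v \<in> fspan n \<mu>s J \<Longrightarrow>
      r \<le> (enorm n (vdiff n v \<mu>))\<^sup>2 + 276 * (\<sigma>\<^sup>2 * real d * ln (real M / (\<delta> * real d)))"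
    and \<theta>: "\<theta> \<in> qball M q R"
  shows "r \<le> (enorm n (vdiff n (lin_comb n {1..M} \<theta> \<mu>s) \<mu>))\<^sup>2 + 2500 * lq_term M \<sigma> B q R \<delta>"
proof -
  obtain x L where x: "0 < x" and L: "1 \<le> L"
    and T: "\<sigma>\<^sup>2 * L * x \<le> lq_term M \<sigma> B q R \<delta>"
    and BR: "(B * R)\<^sup>2 = \<sigma>\<^sup>2 * L * x powr (2 / q)"
    and lnx: "ln (real M / (\<delta> * x)) \<le> 2 * L"
    using lq_term_level[of \<sigma> \<delta> B R q M] assms by auto
  let ?T = "lq_term M \<sigma> B q R \<delta>"
  let ?risk = "(enorm n (vdiff n (lin_comb n {1..M} \<theta> \<mu>s) \<mu>))\<^sup>2"
  have sL: "0 < \<sigma>\<^sup>2 * L" using assms(1) L by simp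
  then have T0: "0 \<le> ?T" using T x by (meson less_imp_le mult_pos_pos order_trans)
  have T2: "\<sigma>\<^sup>2 * ln (real M / \<delta>) \<le> ?T"
  proof -
    have "ln (real M / \<delta>) \<le> logbar (real M / \<delta>)" by (simp add: logbar_def)
    then have "\<sigma>\<^sup>2 * ln (real M / \<delta>) \<le> \<sigma>\<^sup>2 * logbar (real M / \<delta>)" by (intro mult_left_mono) auto
    then show ?thesis by (simp add: lq_term_def)
  qed
  have M: "0 < real M" using assms(4) by simp
  have sparse: "r \<le> ?risk + (B * R)\<^sup>2 * real k powr (1 - 2 / q)
      + 276 * (\<sigma>\<^sup>2 * real (2 * k) * ln (real M / (\<delta> * real (2 * k))))"
    if k: "1 \<le> k" "2 * k \<le> M" for k
  proof -
    have "\<exists>J\<subseteq>{1..M}. card J \<le> 2 * k \<and> (\<exists>v\<in>fspan n \<mu>s J.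
        (enorm n (vdiff n v \<mu>))\<^sup>2 \<le> ?risk + (B * R)\<^sup>2 * real k powr (1 - 2 / q))"
      by (rule qball_sparse_approximation[OF \<theta> assms(6,7,8) k(1) assms(5)]) (rule \<mu>s)
    then obtain J v where J: "J \<subseteq> {1..M}" "card J \<le> 2 * k" "v \<in> fspan n \<mu>s J"
      "(enorm n (vdiff n v \<mu>))\<^sup>2 \<le> ?risk + (B * R)\<^sup>2 * real k powr (1 - 2 / q)"
      by blast
    obtain J' where J': "J \<subseteq> J'" "J' \<subseteq> {1..M}" "card J' = 2 * k"
      using exists_subset_between[OF J(2) _ J(1)] k(2) by auto
    have "v \<in> fspan n \<mu>s J'"
      using fspan_mono[OF _ J'(1)] J'(2) J(3) finite_subset by blast
    then have "r \<le> (enorm n (vdiff n v \<mu>))\<^sup>2 + 276 * (\<sigma>\<^sup>2 * real (2 * k) * ln (real M / (\<delta> * real (2 * k))))"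
      using k(1) by (intro support_bound[OF J'(2,3)]) auto
    then show ?thesis using J(4) by linarith
  qed
  show ?thesis
  proof (cases "x \<le> 1")
    case True
    have "x powr (2 / q) \<le> x powr 1"
      using True x assms(6,7) by (intro powr_mono') (auto simp: field_simps)
    then have "(B * R)\<^sup>2 \<le> \<sigma>\<^sup>2 * L * x"
      unfolding BR using sL x by (intro mult_left_mono) auto
    moreover have "\<sigma>\<^sup>2 * ln (real M / (\<delta> * 2)) \<le> \<sigma>\<^sup>2 * ln (real M / \<delta>)"
      using assms(2) M by (intro mult_left_mono) (auto simp: field_simps)
    ultimately show ?thesis
      using sparse[of 1] assms(4) T T2 T0 by simp
  next
    case False
    then have x1: "1 < x" by simp
    define k where "k = nat \<lceil>x\<rceil>"
    have k: "x \<le> real k" "real k \<le> 2 * x" "1 \<le> k"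
      using x1 by (auto simp: k_def) linarith+
    have "real k powr (1 - 2 / q) \<le> x powr (1 - 2 / q)"
      using k(1) x assms(6,7) by (intro powr_mono2') (auto simp: field_simps)
    then have "(B * R)\<^sup>2 * real k powr (1 - 2 / q) \<le> \<sigma>\<^sup>2 * L * (x powr (2 / q) * x powr (1 - 2 / q))"
      unfolding BR mult.assoc using L by (intro mult_left_mono) auto
    also have "\<dots> = \<sigma>\<^sup>2 * L * x" using x by (simp flip: powr_add)
    finally have approx: "(B * R)\<^sup>2 * real k powr (1 - 2 / q) \<le> ?T" using T by simp
    show ?thesis
    proof (cases "2 * k \<le> M")
      case True
      let ?d = "real (2 * k)"
      have "ln (real M / (\<delta> * ?d)) \<le> ln (real M / (\<delta> * x))"
        using x M assms(2) k by (subst ln_le_cancel_iff) (auto intro!: divide_left_mono mult_left_mono)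
      then have "\<sigma>\<^sup>2 * ?d * ln (real M / (\<delta> * ?d)) \<le> \<sigma>\<^sup>2 * ?d * (2 * L)"
        using lnx by (intro mult_left_mono) auto
      also have "\<dots> \<le> \<sigma>\<^sup>2 * (4 * x) * (2 * L)"
        using k(2) L by (intro mult_right_mono mult_left_mono) auto
      also have "\<dots> = 8 * (\<sigma>\<^sup>2 * L * x)" by simp
      finally have "\<sigma>\<^sup>2 * ?d * ln (real M / (\<delta> * ?d)) \<le> 8 * ?T" using T by linarith
      then show ?thesis using sparse[OF k(3) True] approx T0 by linarith
    next
      case False
      then have Mx: "real M \<le> 4 * x" using k(2) by linarith
      \<comment> \<open>Here x may be much larger than M; the excess \<open>ln (x / M)\<close> is paid by \<open>M * ln (x / M) \<le> x\<close>.\<close>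
      have "ln (1 / \<delta>) = ln (real M / (\<delta> * x)) + ln (x / real M)"
        using M x assms(2) by (simp add: ln_div ln_mult)
      also have "\<dots> \<le> 2 * L + x / real M"
        using lnx ln_le_minus_one[of "x / real M"] M x by (intro add_mono) auto
      finally have "real M * ln (1 / \<delta>) \<le> real M * (2 * L + x / real M)"
        by (intro mult_left_mono) auto
      also have "\<dots> = real M * (2 * L) + x * 1" using M by (simp add: distrib_left)
      also have "\<dots> \<le> 4 * x * (2 * L) + x * L"
        using Mx L x by (intro add_mono mult_right_mono mult_left_mono) auto
      also have "\<dots> = 9 * (L * x)" by simp
      finally have "\<sigma>\<^sup>2 * (real M * ln (1 / \<delta>)) \<le> \<sigma>\<^sup>2 * (9 * (L * x))"
        by (intro mult_left_mono) auto
      then have "\<sigma>\<^sup>2 * real M * ln (1 / \<delta>) \<le> 9 * ?T" using T by (simp add: mult_ac)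
      moreover have "real M / (\<delta> * real M) = 1 / \<delta>" using M by simp
      ultimately show ?thesis
        using support_bound[of "{1..M}" M "lin_comb n {1..M} \<theta> \<mu>s"] lin_comb_in_fspan assms(4) T0 by simp
    qed
  qed
qed

lemma l1_term_eq_lq_term: "0 < \<sigma> \<Longrightarrow> 0 < B \<Longrightarrow> l1_term M \<sigma> B \<delta> = lq_term M \<sigma> B 1 1 \<delta>"
  by (simp add: l1_term_def lq_term_def powr_half_sqrt logbar_def mult.commute[of \<sigma> "real M"])

lemma oracle_ineqI:
  assumes "\<Theta> \<noteq> {}"
    "\<And>\<theta>. \<theta> \<in> \<Theta> \<Longrightarrow> (enorm n (vdiff n est \<mu>))\<^sup>2 \<le> (enorm n (vdiff n (lin_comb n {1..M} \<theta> \<mu>s) \<mu>))\<^sup>2 + r"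
  shows "oracle_ineq n M \<mu>s \<mu> est \<Theta> r"
proof -
  have "(enorm n (vdiff n est \<mu>))\<^sup>2 - r
      \<le> (INF \<theta>\<in>\<Theta>. (enorm n (vdiff n (lin_comb n {1..M} \<theta> \<mu>s) \<mu>))\<^sup>2)"
    using assms by (intro cINF_greatest) (auto simp: field_simps)
  then show ?thesis by (simp add: oracle_ineq_def)
qed

lemma zero_mem_qball:
  assumes "0 \<le> R" "q = 0 \<Longrightarrow> 1 \<le> R"
  shows "(\<lambda>j\<in>{1..M}. 0) \<in> qball M q R"
  using assms by (auto simp: qball_def rvec_def qnorm_def)

lemma qball_0_fspan:
  assumes "\<theta> \<in> qball M 0 (real D)" "D \<le> M"
  obtains J where "J \<subseteq> {1..M}" "card J = D" "lin_comb n {1..M} \<theta> \<mu>s \<in> fspan n \<mu>s J"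
proof -
  let ?S = "{j \<in> {1..M}. \<theta> j \<noteq> 0}"
  have "card ?S \<le> D" using assms(1) by (simp add: qball_def qnorm_def)
  moreover have "D \<le> card {1..M}" "?S \<subseteq> {1..M}" using assms(2) by auto
  ultimately obtain J where J: "?S \<subseteq> J" "J \<subseteq> {1..M}" "card J = D"
    using exists_subset_between[of ?S D "{1..M}"] by blast
  have "lin_comb n {1..M} \<theta> \<mu>s = lin_comb n J \<theta> \<mu>s"
    unfolding lin_comb_def
  proof (rule restrict_ext)
    fix i show "(\<Sum>j\<in>{1..M}. \<theta> j * \<mu>s j i) = (\<Sum>j\<in>J. \<theta> j * \<mu>s j i)"
      using J by (intro sum.mono_neutral_right) auto
  qed
  then show thesis using that J lin_comb_in_fspan by metis
qed

theorem theorem5: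
  "\<exists>C::real. C > 0 \<and>
    (\<forall>(M::nat) (n::nat) (D::nat) (B::real) (q::real) (R::real) (\<delta>::real) (\<sigma>::real)
       (\<mu>s :: nat \<Rightarrow> nat \<Rightarrow> real) (\<mu> :: nat \<Rightarrow> real).
       M \<ge> 3 \<longrightarrow> n \<ge> 1 \<longrightarrow> D \<in> {1..M} \<longrightarrow> B \<ge> 1 \<longrightarrow> q \<in> {0<..<1} \<longrightarrow> R > 0 \<longrightarrow>
       \<delta> \<in> {0<..<1/2} \<longrightarrow> \<sigma> > 0 \<longrightarrow>
       (\<forall>j\<in>{1..M}. \<mu>s j \<in> rvec n \<and> (enorm n (\<mu>s j))\<^sup>2 \<le> B\<^sup>2) \<longrightarrow>
       \<mu> \<in> rvec n \<longrightarrow>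
       (\<exists>E \<in> sets (gaussian n \<sigma>). measure (gaussian n \<sigma>) E \<ge> 1 - \<delta> \<and>
         (\<forall>\<xi>\<in>E.
            let est = Q_estimator n M \<sigma> (1/2) (20 * \<sigma>\<^sup>2) \<mu>s (vadd n \<mu> \<xi>);
                holds = (\<lambda>\<Theta> \<Delta>. oracle_ineq n M \<mu>s \<mu> est \<Theta> (C * \<Delta>))
            in
              holds (qball M 0 1 \<inter> qball M 1 1) (\<sigma>\<^sup>2 * ln (real M / \<delta>)) \<and>
              holds (qball M 1 1)
                (min (l1_term M \<sigma> B \<delta>) (\<sigma>\<^sup>2 * real M * ln (1 / \<delta>))) \<and>
              holds (rvec M) (\<sigma>\<^sup>2 * real M * ln (1 / \<delta>)) \<and>
              holds (qball M 0 (real D)) (\<sigma>\<^sup>2 * real D * ln (real M / (\<delta> * real D))) \<and>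
              holds (qball M 0 (real D) \<inter> qball M 1 1)
                (min (l1_term M \<sigma> B \<delta>) (\<sigma>\<^sup>2 * real D * ln (real M / (\<delta> * real D)))) \<and>
              holds (qball M q R)
                (min (lq_term M \<sigma> B q R \<delta>) (\<sigma>\<^sup>2 * real M * ln (1 / \<delta>))) \<and>
              holds (qball M 0 (real D) \<inter> qball M q R)
                (min (lq_term M \<sigma> B q R \<delta>) (\<sigma>\<^sup>2 * real D * ln (real M / (\<delta> * real D)))))))"
  \<comment> \<open>The largest constant, 2484 = 9 * 276, arises for lq balls when the full set is used.\<close>
proof (intro exI[of _ 2500] conjI allI impI)
  fix M n D :: nat and B q R \<delta> \<sigma> :: real and \<mu>s :: "nat \<Rightarrow> nat \<Rightarrow> real" and \<mu> :: "nat \<Rightarrow> real"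
  assume M: "3 \<le> M" and "1 \<le> n" and D: "D \<in> {1..M}" and B: "1 \<le> B" and q: "q \<in> {0<..<1}"
    and R: "0 < R" and \<delta>: "\<delta> \<in> {0<..<1/2}" and \<sigma>: "0 < \<sigma>"
    and \<mu>s: "\<forall>j\<in>{1..M}. \<mu>s j \<in> rvec n \<and> (enorm n (\<mu>s j))\<^sup>2 \<le> B\<^sup>2" and "\<mu> \<in> rvec n"
  obtain E where E: "E \<in> sets (gaussian n \<sigma>)" "1 - \<delta> \<le> measure (gaussian n \<sigma>) E"
    "\<And>\<xi> J. \<xi> \<in> E \<Longrightarrow> J \<subseteq> {1..M} \<Longrightarrow>
       noise_partition n M \<sigma> \<mu>s \<xi> J \<le> exp (real (card J) / 5) / (prior M J * \<delta>)"
    using noise_partition_event[OF \<sigma>, of \<delta> n M \<mu>s] \<delta> by auto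
  let ?holds = "\<lambda>\<xi>. let est = Q_estimator n M \<sigma> (1/2) (20 * \<sigma>\<^sup>2) \<mu>s (vadd n \<mu> \<xi>);
            holds = (\<lambda>\<Theta> \<Delta>. oracle_ineq n M \<mu>s \<mu> est \<Theta> (2500 * \<Delta>))
        in
              holds (qball M 0 1 \<inter> qball M 1 1) (\<sigma>\<^sup>2 * ln (real M / \<delta>)) \<and>
              holds (qball M 1 1)
                (min (l1_term M \<sigma> B \<delta>) (\<sigma>\<^sup>2 * real M * ln (1 / \<delta>))) \<and>
              holds (rvec M) (\<sigma>\<^sup>2 * real M * ln (1 / \<delta>)) \<and>
              holds (qball M 0 (real D)) (\<sigma>\<^sup>2 * real D * ln (real M / (\<delta> * real D))) \<and>
              holds (qball M 0 (real D) \<inter> qball M 1 1)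
                (min (l1_term M \<sigma> B \<delta>) (\<sigma>\<^sup>2 * real D * ln (real M / (\<delta> * real D)))) \<and>
              holds (qball M q R)
                (min (lq_term M \<sigma> B q R \<delta>) (\<sigma>\<^sup>2 * real M * ln (1 / \<delta>))) \<and>
              holds (qball M 0 (real D) \<inter> qball M q R)
                (min (lq_term M \<sigma> B q R \<delta>) (\<sigma>\<^sup>2 * real D * ln (real M / (\<delta> * real D))))"
  have "?holds \<xi>" if \<xi>: "\<xi> \<in> E" for \<xi>
  proof -
    define est where "est = Q_estimator n M \<sigma> (1/2) (20 * \<sigma>\<^sup>2) \<mu>s (vadd n \<mu> \<xi>)"
    define r where "r = (enorm n (vdiff n est \<mu>))\<^sup>2"
    define risk where "risk \<theta> = (enorm n (vdiff n (lin_comb n {1..M} \<theta> \<mu>s) \<mu>))\<^sup>2" for \<theta>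
    define dim where "dim d = \<sigma>\<^sup>2 * real d * ln (real M / (\<delta> * real d))" for d
    have support_bound: "r \<le> (enorm n (vdiff n v \<mu>))\<^sup>2 + 276 * (\<sigma>\<^sup>2 * real d * ln (real M / (\<delta> * real d)))"
      if "J \<subseteq> {1..M}" "card J = d" "1 \<le> d" "v \<in> fspan n \<mu>s J" for J d v
      using that \<sigma> \<delta> unfolding r_def
      by (intro sparse_oracle_inequality[OF _ _ _ _ _ _ _ E(3)[OF \<xi>] est_def]) auto
    have dim_mono: "276 * dim d \<le> 2500 * dim d" if "1 \<le> d" "d \<le> M" for d
    proof -
      have "\<delta> * real d \<le> 1 * real M" using \<delta> that by (intro mult_mono) auto
      then have "1 \<le> real M / (\<delta> * real d)" using \<delta> that by simp
      then have "0 \<le> dim d" unfolding dim_def by (intro mult_nonneg_nonneg ln_ge_zero) auto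
      then show ?thesis by simp
    qed
    have full: "r \<le> risk \<theta> + 2500 * dim M" for \<theta>
    proof -
      have "r \<le> risk \<theta> + 276 * dim M"
        unfolding risk_def dim_def using M by (intro support_bound[of "{1..M}"] lin_comb_in_fspan) auto
      then show ?thesis using dim_mono[of M] M by simp
    qed
    have sparse: "r \<le> risk \<theta> + 2500 * dim d" if mem: "\<theta> \<in> qball M 0 (real d)" and d: "1 \<le> d" "d \<le> M" for \<theta> d
    proof -
      obtain J where "J \<subseteq> {1..M}" "card J = d" "lin_comb n {1..M} \<theta> \<mu>s \<in> fspan n \<mu>s J"
        using qball_0_fspan[OF mem d(2)] .
      from support_bound[OF this(1,2) d(1) this(3)] show ?thesis
        using dim_mono[OF d] unfolding risk_def dim_def by linarith
    qed
    have lq: "r \<le> risk \<theta> + 2500 * lq_term M \<sigma> B p S \<delta>"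
      if "\<theta> \<in> qball M p S" "0 < p" "p \<le> 1" "0 < S" for \<theta> p S
      unfolding risk_def using \<mu>s \<sigma> \<delta> M B that support_bound
      by (intro qball_oracle_inequality[where n = n and \<mu>s = \<mu>s]) auto
    have l1: "r \<le> risk \<theta> + 2500 * l1_term M \<sigma> B \<delta>" if "\<theta> \<in> qball M 1 1" for \<theta>
      using lq[OF that] \<sigma> B by (simp add: l1_term_eq_lq_term)
    have holds: "oracle_ineq n M \<mu>s \<mu> est \<Theta> (2500 * \<Delta>)"
      if "\<Theta> \<noteq> {}" "\<And>\<theta>. \<theta> \<in> \<Theta> \<Longrightarrow> r \<le> risk \<theta> + 2500 * \<Delta>" for \<Theta> \<Delta>
      using that unfolding r_def risk_def by (rule oracle_ineqI)
    have min: "r \<le> c + 2500 * min a b" if "r \<le> c + 2500 * a" "r \<le> c + 2500 * b" for a b c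
      using that by (simp add: min_def)
    have dimM: "dim M = \<sigma>\<^sup>2 * real M * ln (1 / \<delta>)" using M by (simp add: dim_def)
    have dim1: "dim 1 = \<sigma>\<^sup>2 * ln (real M / \<delta>)" by (simp add: dim_def)
    have zero: "(\<lambda>j\<in>{1..M}. 0) \<in> qball M 0 (real D)" "(\<lambda>j\<in>{1..M}. 0) \<in> qball M 0 1"
      "(\<lambda>j\<in>{1..M}. 0) \<in> qball M 1 1" "(\<lambda>j\<in>{1..M}. 0) \<in> qball M q R" "(\<lambda>j\<in>{1..M}. 0) \<in> rvec M"
      using D R q by (auto intro!: zero_mem_qball simp: rvec_def)
    show ?thesis
      unfolding Let_def est_def[symmetric] dimM[symmetric] dim1[symmetric] dim_def[symmetric]
      by (intro conjI holds min)
        (use zero D M q R full l1 lq[of _ q R] sparse[of _ D] sparse[of _ 1] in auto)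
  qed
  then show "\<exists>E\<in>sets (gaussian n \<sigma>). 1 - \<delta> \<le> measure (gaussian n \<sigma>) E \<and> (\<forall>\<xi>\<in>E. ?holds \<xi>)"
    using E(1,2) by blast
qed simp

end
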